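(* Let $(M^{4n},Q,\omega)$, $n>1$, be an almost quaternionic skew-Hermitian manifold and let $(N^{2k},\hat J,\hat\omega,\hat g)$ be an almost pseudo-Hermitian submanifold of $M^{4n}$, with adapted basis $\{J_1,J_2,J_3\}$. Then $\tilde\nabla\hat J|_x=0$ if and only if one of the following conditions holds at $x\in N$: (I1) $\gamma_2|_{T_xN}=\gamma_3|_{T_xN}=0$; (I2) $J_2T_xN\perp_\omega T_xN$.
   Context: An almost quaternionic structure on $M^{4n}$ ($n>1$) is a rank-3 subbundle $Q\subset\mathrm{End}(TM)$ locally spanned by an admissible basis $J_1,J_2,J_3$, i.e. $J_a^2=-\mathrm{Id}$, $J_1J_2=J_3=-J_2J_1$. An almost quaternionic skew-Hermitian (qs-H) manifold $(M^{4n},Q,\omega)$ is such a manifold with a non-degenerate 2-form $\omega$ satisfying $\omega(J_aX,J_aY)=\omega(X,Y)$ for every admissible basis. Adapted connection. $N_J(X,Y)=[JX,JY]-J[JX,Y]-J[X,JY]-[X,Y]$. The Obata connection $\nabla^H$ of an admissible basis $H=\{J_a\}$ is the unique connection with $\nabla^HJ_a=0$ and torsion $T^H=\frac16\sum_aN_{J_a}$. With $\mathrm{vol}=\omega^{2n}$, the unimodular Oproiu connection $\nabla^{Q,\mathrm{vol}}$ is the unique connection preserving $Q$ and $\mathrm{vol}$ whose torsion is, for any admissible basis, $T^Q=T^H+\sum_a\partial(\tau_a\otimes J_a)$, where $\tau_a(X)=\frac1{4n-2}\mathrm{tr}(J_aT^H_X)$ and $\partial(\tau\otimes J)(X,Y)=\tau(X)JY-\tau(Y)JX$.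 Then $\nabla^{Q,\omega}=\nabla^{Q,\mathrm{vol}}+A$ with $\omega(A(X,Y),Z)=\frac12(\nabla^{Q,\mathrm{vol}}_X\omega)(Y,Z)$; it preserves $Q$ and $\omega$. Given an admissible basis, local 1-forms $\gamma_a$ are defined by $\nabla^{Q,\omega}_XJ_a=\gamma_c(X)J_b-\gamma_b(X)J_c$ for every cyclic permutation $(a,b,c)$ of $(1,2,3)$. An almost complex submanifold $(N^{2k},\hat J)$ is a submanifold $\iota:N\to M$ with an almost complex structure $\hat J$ that is the restriction to $TN$ of a section of $Q$ along $N$; an adapted basis is a (local) admissible basis with $J_1|_{TN}=\hat J$. An almost pseudo-Hermitian submanifold $(N^{2k},\hat J,\hat\omega,\hat g)$ is an almost complex submanifold with $\hat\omega=\iota^*\omega$ non-degenerate and $\hat g(X,Y)=\hat\omega(X,\hat JY)$. Then $TM|_N=TN\oplus\nu(N)$ with $\nu_x(N)=\{u\in T_xM:\omega(u,v)=0\ \forall v\in T_xN\}$; $\top$ is the projection onto $TN$, and $\tilde\nabla_XY:=(\nabla^{Q,\omega}_XY)^\top$ is the induced connection on $N$. $J_2T_xN\perp_\omega T_xN$ means $\omega(J_2u,v)=0$ for all $u,v\in T_xN$. *)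

theory Defs
  imports "HOL-Analysis.Analysis"
begin

section \<open>Smooth maps between Euclidean spaces\<close>

primrec Ck_on :: "nat \<Rightarrow> 'a::real_normed_vector set \<Rightarrow> ('a \<Rightarrow> 'b::real_normed_vector) \<Rightarrow> bool" where
  "Ck_on 0 S f \<longleftrightarrow> continuous_on S f"
| "Ck_on (Suc k) S f \<longleftrightarrow>
     (\<forall>x\<in>S. f differentiable (at x)) \<and> (\<forall>v. Ck_on k S (\<lambda>x. frechet_derivative f (at x) v))"

text \<open>Only used for open \<^term>\<open>S\<close>.\<close>
definition smooth_on :: "'a::real_normed_vector set \<Rightarrow> ('a \<Rightarrow> 'b::real_normed_vector) \<Rightarrow> bool" where
  "smooth_on S f \<longleftrightarrow> (\<forall>k. Ck_on k S f)"


section \<open>Smooth manifolds\<close>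

text \<open>A manifold is a Hausdorff, second countable type \<^typ>\<open>'m\<close> with a smooth atlas; its dimension
  is that of the Euclidean model space \<^typ>\<open>'e\<close>. A chart is a pair of its domain and the map.\<close>

type_synonym ('m, 'e) chart = "'m set \<times> ('m \<Rightarrow> 'e)"

abbreviation cdom :: "('m, 'e) chart \<Rightarrow> 'm set" where
  "cdom c \<equiv> fst c"

abbreviation cmap :: "('m, 'e) chart \<Rightarrow> 'm \<Rightarrow> 'e" where
  "cmap c \<equiv> snd c"

definition cinv :: "('m, 'e) chart \<Rightarrow> 'e \<Rightarrow> 'm" where
  "cinv c = inv_into (cdom c) (cmap c)"

definition is_chart :: "('m::topological_space, 'e::euclidean_space) chart \<Rightarrow> bool" where
  "is_chart c \<longleftrightarrow> open (cdom c) \<and> open (cmap c ` cdom c) \<and>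
     homeomorphism (cdom c) (cmap c ` cdom c) (cmap c) (cinv c)"

definition smooth_atlas ::
  "('m::{t2_space,second_countable_topology}, 'e::euclidean_space) chart set \<Rightarrow> bool" where
  "smooth_atlas M \<longleftrightarrow> (\<forall>c\<in>M. is_chart c) \<and> (\<Union>c\<in>M. cdom c) = UNIV \<and>
     (\<forall>c\<in>M. \<forall>d\<in>M. smooth_on (cmap c ` (cdom c \<inter> cdom d)) (cmap d \<circ> cinv c))"

definition chart_at :: "('m, 'e) chart set \<Rightarrow> 'm \<Rightarrow> ('m, 'e) chart" where
  "chart_at M p = (SOME c. c \<in> M \<and> p \<in> cdom c)"

text \<open>The tangent space at \<^term>\<open>p\<close> is the model space \<^typ>\<open>'e\<close>, a tangent vector being given by its
  components in the preferred chart \<^term>\<open>chart_at M p\<close>. As the preferred chart varies with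
  \<^term>\<open>p\<close> in an arbitrary way, smoothness of fields is expressed only through
  \<open>coords M c p\<close>, the component map \<open>T\<^sub>pM \<rightarrow> 'e\<close> of an arbitrary chart \<^term>\<open>c\<close> around \<^term>\<open>p\<close>.\<close>

definition coords :: "('m, 'e::euclidean_space) chart set \<Rightarrow> ('m, 'e) chart \<Rightarrow> 'm \<Rightarrow> 'e \<Rightarrow> 'e" where
  "coords M c p v =
     frechet_derivative (cmap c \<circ> cinv (chart_at M p)) (at (cmap (chart_at M p) p)) v"

text \<open>The vector field on \<^term>\<open>cdom c\<close> with constant components \<^term>\<open>e\<close> in the chart \<^term>\<open>c\<close>.\<close>

definition coord_field :: "('m, 'e::euclidean_space) chart set \<Rightarrow> ('m, 'e) chart \<Rightarrow> 'e \<Rightarrow> 'm \<Rightarrow> 'e" where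
  "coord_field M c e p = frechet_derivative (cmap (chart_at M p) \<circ> cinv c) (at (cmap c p)) e"

text \<open>The derivative \<open>u(f)\<close> of a function along \<open>u \<in> T\<^sub>pM\<close>.\<close>

definition dir_deriv ::
  "('m, 'e::euclidean_space) chart set \<Rightarrow> 'm \<Rightarrow> 'e \<Rightarrow> ('m \<Rightarrow> real) \<Rightarrow> real" where
  "dir_deriv M p u f =
     frechet_derivative (f \<circ> cinv (chart_at M p)) (at (cmap (chart_at M p) p)) u"

definition smooth_fun :: "('m, 'e::euclidean_space) chart set \<Rightarrow> 'm set \<Rightarrow> ('m \<Rightarrow> real) \<Rightarrow> bool" where
  "smooth_fun M U f \<longleftrightarrow> (\<forall>c\<in>M. smooth_on (cmap c ` (U \<inter> cdom c)) (f \<circ> cinv c))"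

definition vector_field :: "('m, 'e::euclidean_space) chart set \<Rightarrow> 'm set \<Rightarrow> ('m \<Rightarrow> 'e) \<Rightarrow> bool" where
  "vector_field M U X \<longleftrightarrow>
     (\<forall>c\<in>M. smooth_on (cmap c ` (U \<inter> cdom c)) ((\<lambda>p. coords M c p (X p)) \<circ> cinv c))"

definition smooth_fun_near ::
  "('m::topological_space, 'e::euclidean_space) chart set \<Rightarrow> 'm \<Rightarrow> ('m \<Rightarrow> real) \<Rightarrow> bool" where
  "smooth_fun_near M p f \<longleftrightarrow> (\<exists>U. open U \<and> p \<in> U \<and> smooth_fun M U f)"

definition vector_field_near ::
  "('m::topological_space, 'e::euclidean_space) chart set \<Rightarrow> 'm \<Rightarrow> ('m \<Rightarrow> 'e) \<Rightarrow> bool" where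
  "vector_field_near M p X \<longleftrightarrow> (\<exists>U. open U \<and> p \<in> U \<and> vector_field M U X)"

definition endo_field ::
  "('m::topological_space, 'e::euclidean_space) chart set \<Rightarrow> 'm set \<Rightarrow> ('m \<Rightarrow> 'e \<Rightarrow> 'e) \<Rightarrow> bool" where
  "endo_field M U A \<longleftrightarrow> (\<forall>p\<in>U. linear (A p)) \<and>
     (\<forall>W X. open W \<and> W \<subseteq> U \<and> vector_field M W X \<longrightarrow> vector_field M W (\<lambda>p. A p (X p)))"

definition one_form ::
  "('m::topological_space, 'e::euclidean_space) chart set \<Rightarrow> 'm set \<Rightarrow> ('m \<Rightarrow> 'e \<Rightarrow> real) \<Rightarrow> bool" where
  "one_form M U \<gamma> \<longleftrightarrow> (\<forall>p\<in>U. linear (\<gamma> p)) \<and>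
     (\<forall>W X. open W \<and> W \<subseteq> U \<and> vector_field M W X \<longrightarrow> smooth_fun M W (\<lambda>p. \<gamma> p (X p)))"

definition two_form ::
  "('m::topological_space, 'e::euclidean_space) chart set \<Rightarrow> ('m \<Rightarrow> 'e \<Rightarrow> 'e \<Rightarrow> real) \<Rightarrow> bool" where
  "two_form M \<omega> \<longleftrightarrow> (\<forall>p. bilinear (\<omega> p) \<and> (\<forall>u v. \<omega> p u v = - \<omega> p v u)) \<and>
     (\<forall>W X Y. open W \<and> vector_field M W X \<and> vector_field M W Y \<longrightarrow>
        smooth_fun M W (\<lambda>p. \<omega> p (X p) (Y p)))"

definition nondegenerate :: "('m \<Rightarrow> 'e \<Rightarrow> 'e::real_vector \<Rightarrow> real) \<Rightarrow> bool" where
  "nondegenerate \<omega> \<longleftrightarrow> (\<forall>p u. (\<forall>v. \<omega> p u v = 0) \<longrightarrow> u = 0)"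

text \<open>The Lie bracket, by its coordinate expression \<open>[X,Y] = DY(X) - DX(Y)\<close> in the preferred chart.\<close>

definition bracket ::
  "('m, 'e::euclidean_space) chart set \<Rightarrow> 'm \<Rightarrow> ('m \<Rightarrow> 'e) \<Rightarrow> ('m \<Rightarrow> 'e) \<Rightarrow> 'e" where
  "bracket M p X Y =
     (let c = chart_at M p;
          rep = (\<lambda>Z. (\<lambda>q. coords M c q (Z q)) \<circ> cinv c)
      in frechet_derivative (rep Y) (at (cmap c p)) (X p)
         - frechet_derivative (rep X) (at (cmap c p)) (Y p))"

definition endo_trace :: "('e::euclidean_space \<Rightarrow> 'e) \<Rightarrow> real" where
  "endo_trace A = (\<Sum>b\<in>Basis. A b \<bullet> b)"


section \<open>Affine connections\<close>

text \<open>\<open>D p u Y\<close> stands for \<open>\<nabla>\<^sub>u Y\<close> at \<^term>\<open>p\<close>, where \<open>u \<in> T\<^sub>pM\<close> and \<^term>\<open>Y\<close> is a vector field defined near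
  \<^term>\<open>p\<close>. The Leibniz rule is required for all functions that are smooth merely near \<^term>\<open>p\<close>
  (possibly discontinuous elsewhere), so that the usual dependence of \<open>\<nabla>\<^sub>u Y\<close> on the germ of
  \<^term>\<open>Y\<close> only is a consequence.\<close>

type_synonym ('m, 'e) conn = "'m \<Rightarrow> 'e \<Rightarrow> ('m \<Rightarrow> 'e) \<Rightarrow> 'e"

definition connection_on ::
  "('m::topological_space, 'e::euclidean_space) chart set \<Rightarrow> 'm set \<Rightarrow> ('m, 'e) conn \<Rightarrow> bool" where
  "connection_on M U D \<longleftrightarrow>
     (\<forall>p\<in>U. \<forall>Y. vector_field_near M p Y \<longrightarrow> linear (\<lambda>u. D p u Y)) \<and>
     (\<forall>p\<in>U. \<forall>u Y Z. vector_field_near M p Y \<and> vector_field_near M p Z \<longrightarrow>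
        D p u (\<lambda>q. Y q + Z q) = D p u Y + D p u Z) \<and>
     (\<forall>p\<in>U. \<forall>u f Y. smooth_fun_near M p f \<and> vector_field_near M p Y \<longrightarrow>
        D p u (\<lambda>q. f q *\<^sub>R Y q) = dir_deriv M p u f *\<^sub>R Y p + f p *\<^sub>R D p u Y) \<and>
     (\<forall>W X Y. open W \<and> W \<subseteq> U \<and> vector_field M W X \<and> vector_field M W Y \<longrightarrow>
        vector_field M W (\<lambda>p. D p (X p) Y))"

definition torsion ::
  "('m, 'e::euclidean_space) chart set \<Rightarrow> ('m, 'e) conn \<Rightarrow> 'm \<Rightarrow> ('m \<Rightarrow> 'e) \<Rightarrow> ('m \<Rightarrow> 'e) \<Rightarrow> 'e" where
  "torsion M D p X Y = D p (X p) Y - D p (Y p) X - bracket M p X Y"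

text \<open>\<open>(\<nabla>\<^sub>u A) Y\<close> and \<open>(\<nabla>\<^sub>u \<omega>)(Y, Z)\<close>; both are tensorial in the vector fields.\<close>

definition nabla_endo :: "('m, 'e::ab_group_add) conn \<Rightarrow> ('m \<Rightarrow> 'e \<Rightarrow> 'e) \<Rightarrow> 'm \<Rightarrow> 'e \<Rightarrow> ('m \<Rightarrow> 'e) \<Rightarrow> 'e" where
  "nabla_endo D A p u Y = D p u (\<lambda>q. A q (Y q)) - A p (D p u Y)"

definition nabla_form ::
  "('m, 'e::euclidean_space) chart set \<Rightarrow> ('m, 'e) conn \<Rightarrow> ('m \<Rightarrow> 'e \<Rightarrow> 'e \<Rightarrow> real) \<Rightarrow>
     'm \<Rightarrow> 'e \<Rightarrow> ('m \<Rightarrow> 'e) \<Rightarrow> ('m \<Rightarrow> 'e) \<Rightarrow> real" where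
  "nabla_form M D \<omega> p u Y Z =
     dir_deriv M p u (\<lambda>q. \<omega> q (Y q) (Z q)) - \<omega> p (D p u Y) (Z p) - \<omega> p (Y p) (D p u Z)"


section \<open>Almost quaternionic skew-Hermitian manifolds\<close>

text \<open>\<open>Q p\<close> is the fibre at \<^term>\<open>p\<close> of a bundle of endomorphisms of the tangent spaces. Local bases
  \<open>J\<^sub>1, J\<^sub>2, J\<^sub>3\<close> are indexed by natural numbers, only the indices 1, 2, 3 being relevant. The
  quaternionic relations make them linearly independent, so that \<^term>\<open>Q\<close> has rank 3.\<close>

definition admissible_basis ::
  "('m::topological_space, 'e::euclidean_space) chart set \<Rightarrow> ('m \<Rightarrow> ('e \<Rightarrow> 'e) set) \<Rightarrow> 'm set \<Rightarrow>
     (nat \<Rightarrow> 'm \<Rightarrow> 'e \<Rightarrow> 'e) \<Rightarrow> bool" where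
  "admissible_basis M Q U J \<longleftrightarrow> open U \<and> (\<forall>a\<in>{1,2,3}. endo_field M U (J a)) \<and>
     (\<forall>p\<in>U. (\<forall>a\<in>{1,2,3}. \<forall>v. J a p (J a p v) = - v) \<and>
             (\<forall>v. J 1 p (J 2 p v) = J 3 p v \<and> J 3 p v = - J 2 p (J 1 p v)) \<and>
             Q p = {(\<lambda>v. \<Sum>a\<in>{1,2,3}. s a *\<^sub>R J a p v) | s :: nat \<Rightarrow> real. True})"

definition almost_quaternionic ::
  "('m::topological_space, 'e::euclidean_space) chart set \<Rightarrow> ('m \<Rightarrow> ('e \<Rightarrow> 'e) set) \<Rightarrow> bool" where
  "almost_quaternionic M Q \<longleftrightarrow> (\<forall>p. \<exists>U J. p \<in> U \<and> admissible_basis M Q U J)"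

definition almost_qsH ::
  "nat \<Rightarrow> ('m::{t2_space,second_countable_topology}, 'e::euclidean_space) chart set \<Rightarrow>
     ('m \<Rightarrow> ('e \<Rightarrow> 'e) set) \<Rightarrow> ('m \<Rightarrow> 'e \<Rightarrow> 'e \<Rightarrow> real) \<Rightarrow> bool" where
  "almost_qsH n M Q \<omega> \<longleftrightarrow> smooth_atlas M \<and> DIM('e) = 4 * n \<and> almost_quaternionic M Q \<and>
     two_form M \<omega> \<and> nondegenerate \<omega> \<and>
     (\<forall>U J. admissible_basis M Q U J \<longrightarrow>
        (\<forall>p\<in>U. \<forall>a\<in>{1,2,3}. \<forall>u v. \<omega> p (J a p u) (J a p v) = \<omega> p u v))"


section \<open>The adapted connection\<close>

definition nijenhuis ::
  "('m, 'e::euclidean_space) chart set \<Rightarrow> ('m \<Rightarrow> 'e \<Rightarrow> 'e) \<Rightarrow> 'm \<Rightarrow> ('m \<Rightarrow> 'e) \<Rightarrow> ('m \<Rightarrow> 'e) \<Rightarrow> 'e" where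
  "nijenhuis M J p X Y =
     bracket M p (\<lambda>q. J q (X q)) (\<lambda>q. J q (Y q))
     - J p (bracket M p (\<lambda>q. J q (X q)) Y)
     - J p (bracket M p X (\<lambda>q. J q (Y q)))
     - bracket M p X Y"

definition obata_connection ::
  "('m::topological_space, 'e::euclidean_space) chart set \<Rightarrow> 'm set \<Rightarrow> (nat \<Rightarrow> 'm \<Rightarrow> 'e \<Rightarrow> 'e) \<Rightarrow>
     ('m, 'e) conn \<Rightarrow> bool" where
  "obata_connection M U J D \<longleftrightarrow> connection_on M U D \<and>
     (\<forall>p\<in>U. \<forall>u Y. vector_field_near M p Y \<longrightarrow> (\<forall>a\<in>{1,2,3}. nabla_endo D (J a) p u Y = 0)) \<and>
     (\<forall>p\<in>U. \<forall>X Y. vector_field_near M p X \<and> vector_field_near M p Y \<longrightarrow>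
        torsion M D p X Y = (1 / 6) *\<^sub>R (\<Sum>a\<in>{1,2,3}. nijenhuis M (J a) p X Y))"

text \<open>\<open>\<tau>(u) = tr(J T\<^sub>u) / (4n - 2)\<close>, where the torsion \<open>T\<close> of \<^term>\<open>D\<close> is evaluated on tangent vectors by
  extending them with constant components in the preferred chart at \<^term>\<open>p\<close>.\<close>

definition oproiu_tau ::
  "nat \<Rightarrow> ('m, 'e::euclidean_space) chart set \<Rightarrow> ('m, 'e) conn \<Rightarrow> ('m \<Rightarrow> 'e \<Rightarrow> 'e) \<Rightarrow> 'm \<Rightarrow> 'e \<Rightarrow> real" where
  "oproiu_tau n M D J p u =
     1 / (4 * real n - 2) *
     endo_trace (\<lambda>v. J p (torsion M D p (coord_field M (chart_at M p) u)
                                        (coord_field M (chart_at M p) v)))"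

definition alt_tensor ::
  "('m \<Rightarrow> 'e \<Rightarrow> real) \<Rightarrow> ('m \<Rightarrow> 'e \<Rightarrow> 'e) \<Rightarrow> 'm \<Rightarrow> ('m \<Rightarrow> 'e) \<Rightarrow> ('m \<Rightarrow> 'e) \<Rightarrow> 'e::real_vector" where
  "alt_tensor \<tau> J p X Y = \<tau> p (X p) *\<^sub>R J p (Y p) - \<tau> p (Y p) *\<^sub>R J p (X p)"

text \<open>The exterior power \<open>\<omega>\<^sup>m\<close> evaluated on the vectors \<open>v 0, \<dots>, v (2m - 1)\<close>, i.e. \<open>2\<^sup>-\<^sup>m\<close> times the
  alternating sum over all permutations.\<close>

definition form_power :: "nat \<Rightarrow> ('e \<Rightarrow> 'e \<Rightarrow> real) \<Rightarrow> (nat \<Rightarrow> 'e) \<Rightarrow> real" where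
  "form_power m \<omega> v = (1 / 2 ^ m) *
     (\<Sum>\<sigma> | \<sigma> permutes {..<2 * m}.
        of_int (sign \<sigma>) * (\<Prod>i<m. \<omega> (v (\<sigma> (2 * i))) (v (\<sigma> (2 * i + 1)))))"

definition preserves_Q ::
  "('m::topological_space, 'e::euclidean_space) chart set \<Rightarrow> ('m \<Rightarrow> ('e \<Rightarrow> 'e) set) \<Rightarrow>
     ('m, 'e) conn \<Rightarrow> bool" where
  "preserves_Q M Q D \<longleftrightarrow>
     (\<forall>U A. open U \<and> endo_field M U A \<and> (\<forall>p\<in>U. A p \<in> Q p) \<longrightarrow>
        (\<forall>p\<in>U. \<forall>u. \<exists>B\<in>Q p. \<forall>Y. vector_field_near M p Y \<longrightarrow> nabla_endo D A p u Y = B (Y p)))"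

definition preserves_vol ::
  "nat \<Rightarrow> ('m::topological_space, 'e::euclidean_space) chart set \<Rightarrow> ('m \<Rightarrow> 'e \<Rightarrow> 'e \<Rightarrow> real) \<Rightarrow>
     ('m, 'e) conn \<Rightarrow> bool" where
  "preserves_vol n M \<omega> D \<longleftrightarrow>
     (\<forall>p u Y. (\<forall>i<4 * n. vector_field_near M p (Y i)) \<longrightarrow>
        dir_deriv M p u (\<lambda>q. form_power (2 * n) (\<omega> q) (\<lambda>i. Y i q)) =
        (\<Sum>i<4 * n. form_power (2 * n) (\<omega> p) (\<lambda>j. if j = i then D p u (Y i) else Y j p)))"

definition unimodular_oproiu_connection ::
  "nat \<Rightarrow> ('m::topological_space, 'e::euclidean_space) chart set \<Rightarrow> ('m \<Rightarrow> ('e \<Rightarrow> 'e) set) \<Rightarrow>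
     ('m \<Rightarrow> 'e \<Rightarrow> 'e \<Rightarrow> real) \<Rightarrow> ('m, 'e) conn \<Rightarrow> bool" where
  "unimodular_oproiu_connection n M Q \<omega> D \<longleftrightarrow>
     connection_on M UNIV D \<and> preserves_Q M Q D \<and> preserves_vol n M \<omega> D \<and>
     (\<forall>U J D\<^sub>H. admissible_basis M Q U J \<and> obata_connection M U J D\<^sub>H \<longrightarrow>
        (\<forall>p\<in>U. \<forall>X Y. vector_field_near M p X \<and> vector_field_near M p Y \<longrightarrow>
           torsion M D p X Y = torsion M D\<^sub>H p X Y +
             (\<Sum>a\<in>{1,2,3}. alt_tensor (oproiu_tau n M D\<^sub>H (J a)) (J a) p X Y)))"

text \<open>The connection \<open>\<nabla>\<^sup>Q\<^sup>,\<^sup>\<omega> = \<nabla>\<^sup>Q\<^sup>,\<^sup>v\<^sup>o\<^sup>l + A\<close>, up to its irrelevant values on arguments that are not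
  smooth near the point.\<close>

definition adapted_connection ::
  "nat \<Rightarrow> ('m::topological_space, 'e::euclidean_space) chart set \<Rightarrow> ('m \<Rightarrow> ('e \<Rightarrow> 'e) set) \<Rightarrow>
     ('m \<Rightarrow> 'e \<Rightarrow> 'e \<Rightarrow> real) \<Rightarrow> ('m, 'e) conn \<Rightarrow> bool" where
  "adapted_connection n M Q \<omega> D \<longleftrightarrow> connection_on M UNIV D \<and>
     (\<exists>D\<^sub>v A. unimodular_oproiu_connection n M Q \<omega> D\<^sub>v \<and>
        (\<forall>p u Y. vector_field_near M p Y \<longrightarrow> D p u Y = D\<^sub>v p u Y + A p u (Y p)) \<and>
        (\<forall>p u Y Z. vector_field_near M p Y \<and> vector_field_near M p Z \<longrightarrow>
           \<omega> p (A p u (Y p)) (Z p) = (1 / 2) * nabla_form M D\<^sub>v \<omega> p u Y Z))"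

definition connection_forms ::
  "('m::topological_space, 'e::euclidean_space) chart set \<Rightarrow> 'm set \<Rightarrow> ('m, 'e) conn \<Rightarrow>
     (nat \<Rightarrow> 'm \<Rightarrow> 'e \<Rightarrow> 'e) \<Rightarrow> (nat \<Rightarrow> 'm \<Rightarrow> 'e \<Rightarrow> real) \<Rightarrow> bool" where
  "connection_forms M U D J \<gamma> \<longleftrightarrow> (\<forall>a\<in>{1,2,3}. one_form M U (\<gamma> a)) \<and>
     (\<forall>(a, b, c)\<in>{(1,2,3), (2,3,1), (3,1,2)}. \<forall>p\<in>U. \<forall>u Y. vector_field_near M p Y \<longrightarrow>
        nabla_endo D (J a) p u Y = \<gamma> c p u *\<^sub>R J b p (Y p) - \<gamma> b p u *\<^sub>R J c p (Y p))"


section \<open>Submanifolds\<close>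

definition differential ::
  "('k, 'f::euclidean_space) chart set \<Rightarrow> ('m, 'e::euclidean_space) chart set \<Rightarrow> ('k \<Rightarrow> 'm) \<Rightarrow>
     'k \<Rightarrow> 'f \<Rightarrow> 'e" where
  "differential N M \<iota> y v =
     frechet_derivative (cmap (chart_at M (\<iota> y)) \<circ> \<iota> \<circ> cinv (chart_at N y))
       (at (cmap (chart_at N y) y)) v"

definition smooth_map ::
  "('k::topological_space, 'f::euclidean_space) chart set \<Rightarrow>
     ('m::topological_space, 'e::euclidean_space) chart set \<Rightarrow> ('k \<Rightarrow> 'm) \<Rightarrow> bool" where
  "smooth_map N M \<iota> \<longleftrightarrow> continuous_on UNIV \<iota> \<and>
     (\<forall>d\<in>N. \<forall>c\<in>M. smooth_on (cmap d ` (cdom d \<inter> \<iota> -` cdom c)) (cmap c \<circ> \<iota> \<circ> cinv d))"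

text \<open>Submanifolds are injectively immersed (embedded ones included).\<close>

definition submanifold ::
  "('k::{t2_space,second_countable_topology}, 'f::euclidean_space) chart set \<Rightarrow>
     ('m::{t2_space,second_countable_topology}, 'e::euclidean_space) chart set \<Rightarrow> ('k \<Rightarrow> 'm) \<Rightarrow> bool" where
  "submanifold N M \<iota> \<longleftrightarrow> smooth_atlas N \<and> smooth_atlas M \<and> smooth_map N M \<iota> \<and> inj \<iota> \<and>
     (\<forall>y. inj (differential N M \<iota> y))"

text \<open>Sections over \<^term>\<open>V\<close> of the pull-backs of \<open>TM\<close> and of \<open>End(TM)\<close> by \<open>\<iota>\<close>.\<close>

definition field_along ::
  "('k, 'f::euclidean_space) chart set \<Rightarrow> ('m, 'e::euclidean_space) chart set \<Rightarrow> ('k \<Rightarrow> 'm) \<Rightarrow>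
     'k set \<Rightarrow> ('k \<Rightarrow> 'e) \<Rightarrow> bool" where
  "field_along N M \<iota> V Z \<longleftrightarrow>
     (\<forall>d\<in>N. \<forall>c\<in>M. smooth_on (cmap d ` (V \<inter> cdom d \<inter> \<iota> -` cdom c))
        ((\<lambda>y. coords M c (\<iota> y) (Z y)) \<circ> cinv d))"

definition endo_along ::
  "('k, 'f::euclidean_space) chart set \<Rightarrow> ('m::topological_space, 'e::euclidean_space) chart set \<Rightarrow>
     ('k \<Rightarrow> 'm) \<Rightarrow> 'k set \<Rightarrow> ('k \<Rightarrow> 'e \<Rightarrow> 'e) \<Rightarrow> bool" where
  "endo_along N M \<iota> V I \<longleftrightarrow> (\<forall>y\<in>V. linear (I y)) \<and>
     (\<forall>W X. open W \<and> vector_field M W X \<longrightarrow>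
        field_along N M \<iota> (V \<inter> \<iota> -` W) (\<lambda>y. I y (X (\<iota> y))))"

definition almost_complex_structure ::
  "('k::topological_space, 'f::euclidean_space) chart set \<Rightarrow> ('k \<Rightarrow> 'f \<Rightarrow> 'f) \<Rightarrow> bool" where
  "almost_complex_structure N Jh \<longleftrightarrow> endo_field N UNIV Jh \<and> (\<forall>y v. Jh y (Jh y v) = - v)"

definition almost_complex_submanifold ::
  "('k::{t2_space,second_countable_topology}, 'f::euclidean_space) chart set \<Rightarrow>
     ('m::{t2_space,second_countable_topology}, 'e::euclidean_space) chart set \<Rightarrow>
     ('m \<Rightarrow> ('e \<Rightarrow> 'e) set) \<Rightarrow> ('k \<Rightarrow> 'm) \<Rightarrow> ('k \<Rightarrow> 'f \<Rightarrow> 'f) \<Rightarrow> bool" where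
  "almost_complex_submanifold N M Q \<iota> Jh \<longleftrightarrow> submanifold N M \<iota> \<and> almost_complex_structure N Jh \<and>
     (\<exists>I. endo_along N M \<iota> UNIV I \<and>
        (\<forall>y. I y \<in> Q (\<iota> y) \<and>
             (\<forall>v. I y (differential N M \<iota> y v) = differential N M \<iota> y (Jh y v))))"

definition adapted_basis ::
  "('k::topological_space, 'f::euclidean_space) chart set \<Rightarrow>
     ('m::topological_space, 'e::euclidean_space) chart set \<Rightarrow> ('m \<Rightarrow> ('e \<Rightarrow> 'e) set) \<Rightarrow>
     ('k \<Rightarrow> 'm) \<Rightarrow> ('k \<Rightarrow> 'f \<Rightarrow> 'f) \<Rightarrow> 'k set \<Rightarrow> 'm set \<Rightarrow> (nat \<Rightarrow> 'm \<Rightarrow> 'e \<Rightarrow> 'e) \<Rightarrow> bool" where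
  "adapted_basis N M Q \<iota> Jh V U J \<longleftrightarrow> admissible_basis M Q U J \<and> open V \<and> \<iota> ` V \<subseteq> U \<and>
     (\<forall>y\<in>V. \<forall>v. J 1 (\<iota> y) (differential N M \<iota> y v) = differential N M \<iota> y (Jh y v))"

definition pullback_form ::
  "('k, 'f::euclidean_space) chart set \<Rightarrow> ('m, 'e::euclidean_space) chart set \<Rightarrow> ('k \<Rightarrow> 'm) \<Rightarrow>
     ('m \<Rightarrow> 'e \<Rightarrow> 'e \<Rightarrow> real) \<Rightarrow> 'k \<Rightarrow> 'f \<Rightarrow> 'f \<Rightarrow> real" where
  "pullback_form N M \<iota> \<omega> y u v = \<omega> (\<iota> y) (differential N M \<iota> y u) (differential N M \<iota> y v)"

definition almost_pseudo_Hermitian_submanifold ::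
  "('k::{t2_space,second_countable_topology}, 'f::euclidean_space) chart set \<Rightarrow>
     ('m::{t2_space,second_countable_topology}, 'e::euclidean_space) chart set \<Rightarrow>
     ('m \<Rightarrow> ('e \<Rightarrow> 'e) set) \<Rightarrow> ('m \<Rightarrow> 'e \<Rightarrow> 'e \<Rightarrow> real) \<Rightarrow> ('k \<Rightarrow> 'm) \<Rightarrow>
     ('k \<Rightarrow> 'f \<Rightarrow> 'f) \<Rightarrow> ('k \<Rightarrow> 'f \<Rightarrow> 'f \<Rightarrow> real) \<Rightarrow> ('k \<Rightarrow> 'f \<Rightarrow> 'f \<Rightarrow> real) \<Rightarrow> bool" where
  "almost_pseudo_Hermitian_submanifold N M Q \<omega> \<iota> Jh \<omega>h gh \<longleftrightarrow>
     almost_complex_submanifold N M Q \<iota> Jh \<and>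
     \<omega>h = pullback_form N M \<iota> \<omega> \<and> nondegenerate \<omega>h \<and>
     (\<forall>y u v. gh y u v = \<omega>h y u (Jh y v))"

definition normal_space ::
  "('k, 'f::euclidean_space) chart set \<Rightarrow> ('m, 'e::euclidean_space) chart set \<Rightarrow> ('k \<Rightarrow> 'm) \<Rightarrow>
     ('m \<Rightarrow> 'e \<Rightarrow> 'e \<Rightarrow> real) \<Rightarrow> 'k \<Rightarrow> 'e set" where
  "normal_space N M \<iota> \<omega> y = {u. \<forall>v. \<omega> (\<iota> y) u (differential N M \<iota> y v) = 0}"

text \<open>The projection onto \<open>T\<^sub>yN\<close> along the normal space, as an element of \<open>T\<^sub>yN\<close>.\<close>

definition tangential ::
  "('k, 'f::euclidean_space) chart set \<Rightarrow> ('m, 'e::euclidean_space) chart set \<Rightarrow> ('k \<Rightarrow> 'm) \<Rightarrow>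
     ('m \<Rightarrow> 'e \<Rightarrow> 'e \<Rightarrow> real) \<Rightarrow> 'k \<Rightarrow> 'e \<Rightarrow> 'f" where
  "tangential N M \<iota> \<omega> y w = (THE v. w - differential N M \<iota> y v \<in> normal_space N M \<iota> \<omega> y)"

text \<open>\<open>\<nabla>\<^sub>u Z\<close> for \<open>u \<in> T\<^sub>yN\<close> and a vector field \<open>Z\<close> along \<open>\<iota>\<close>, i.e. the pull-back connection: if
  \<open>Z = \<Sum> Z\<^sup>b \<partial>\<^sub>b\<close> in the coordinate frame of a chart of \<open>M\<close>, then
  \<open>\<nabla>\<^sub>u Z = \<Sum> (u(Z\<^sup>b) \<partial>\<^sub>b + Z\<^sup>b \<nabla>\<^sub>u \<partial>\<^sub>b)\<close>. It agrees with \<open>\<nabla>\<^sub>u\<close> of any local extension of \<open>Z\<close> to \<open>M\<close>.\<close>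

definition conn_along ::
  "('k, 'f::euclidean_space) chart set \<Rightarrow> ('m, 'e::euclidean_space) chart set \<Rightarrow> ('k \<Rightarrow> 'm) \<Rightarrow>
     ('m, 'e) conn \<Rightarrow> 'k \<Rightarrow> 'f \<Rightarrow> ('k \<Rightarrow> 'e) \<Rightarrow> 'e" where
  "conn_along N M \<iota> D y u Z =
     (let c = chart_at M (\<iota> y); comp = (\<lambda>b z. coords M c (\<iota> z) (Z z) \<bullet> b)
      in \<Sum>b\<in>Basis. dir_deriv N y u (comp b) *\<^sub>R coord_field M c b (\<iota> y)
                  + comp b y *\<^sub>R D (\<iota> y) (differential N M \<iota> y u) (coord_field M c b))"

definition induced_connection ::
  "('k, 'f::euclidean_space) chart set \<Rightarrow> ('m, 'e::euclidean_space) chart set \<Rightarrow> ('k \<Rightarrow> 'm) \<Rightarrow>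
     ('m \<Rightarrow> 'e \<Rightarrow> 'e \<Rightarrow> real) \<Rightarrow> ('m, 'e) conn \<Rightarrow> ('k, 'f) conn" where
  "induced_connection N M \<iota> \<omega> D y u Y =
     tangential N M \<iota> \<omega> y (conn_along N M \<iota> D y u (\<lambda>z. differential N M \<iota> z (Y z)))"

end

theory Submission
  imports Defs
begin

text \<open>Since \<open>J\<^sub>1\<close> preserves \<open>TN\<close> and \<open>\<omega>\<close>, it commutes with the tangential projection, so the Leibniz rule
  gives \<open>(\<nabla>\<^sub>u J\<^sub>1) y = (\<gamma>\<^sub>3(u) J\<^sub>2 y - \<gamma>\<^sub>2(u) J\<^sub>3 y)\<^sup>T\<close> for the induced connection. As
  \<open>J\<^sub>3 = - J\<^sub>2 J\<^sub>1\<close>, with \<open>B(y, v) = \<omega>(J\<^sub>2 y, v)\<close> on \<open>TN\<close> this vanishes iff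
  \<open>\<gamma>\<^sub>3(u) B(y, v) + \<gamma>\<^sub>2(u) B(J\<^sub>1 y, v) = 0\<close> for all \<open>y, v\<close>. Replacing \<open>y\<close> by \<open>J\<^sub>1 y\<close> gives a second
  equation; the determinant of the system is \<open>\<gamma>\<^sub>2(u)\<^sup>2 + \<gamma>\<^sub>3(u)\<^sup>2\<close>, so either \<open>B = 0\<close> or both
  \<open>\<gamma>\<^sub>2\<close> and \<open>\<gamma>\<^sub>3\<close> vanish on \<open>TN\<close>.\<close>

section \<open>Smooth maps\<close>

text \<open>The derivative is chosen from the relation \<open>has_derivative\<close>, and maps
  agreeing on an open set around the point satisfy this relation for the same \<open>D\<close>. So
  the chosen values coincide even where neither map is differentiable.\<close>

lemma frechet_derivative_cong_open:
  assumes "open S" "x \<in> S" "\<And>y. y \<in> S \<Longrightarrow> f y = g y"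
  shows "frechet_derivative f (at x) = frechet_derivative g (at x)"
proof -
  have "(f has_derivative D) (at x) \<longleftrightarrow> (g has_derivative D) (at x)" for D
    using has_derivative_transform_within_open[OF _ assms(1,2), of f D UNIV g]
      has_derivative_transform_within_open[OF _ assms(1,2), of g D UNIV f] assms(3)
    by auto
  then show ?thesis
    by (simp add: frechet_derivative_def)
qed

lemma differentiable_cong_open:
  assumes "open S" "x \<in> S" "\<And>y. y \<in> S \<Longrightarrow> f y = g y" "f differentiable (at x)"
  shows "g differentiable (at x)"
  using assms has_derivative_transform_within_open[OF _ assms(1,2)]
  unfolding differentiable_def by metis

lemma has_frechet_derivative:
  "f differentiable (at x) \<Longrightarrow> (f has_derivative frechet_derivative f (at x)) (at x)"
  by (simp add: frechet_derivative_works)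

lemma frechet_derivative_compose_apply:
  assumes "f differentiable (at (g x))" "g differentiable (at x)"
  shows "frechet_derivative (\<lambda>x. f (g x)) (at x) v =
    frechet_derivative f (at (g x)) (frechet_derivative g (at x) v)"
  using frechet_derivative_compose[of g x f] assms by (simp add: o_def fun_eq_iff)

text \<open>The derivatives in \<open>Ck_on\<close> are taken in the whole space and not within
  \<open>S\<close>, so the smaller set may be arbitrary.\<close>

lemma Ck_on_subset: "Ck_on k S f \<Longrightarrow> T \<subseteq> S \<Longrightarrow> Ck_on k T f"
  by (induction k arbitrary: f) (auto intro: continuous_on_subset)

text \<open>Openness makes agreement on \<open>S\<close> an agreement near each point, which the
  full derivatives detect. The induction varies \<open>f\<close> and \<open>g\<close>, since it
  passes to their directional derivatives.\<close>

lemma Ck_on_cong: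
  assumes "open S" "\<And>x. x \<in> S \<Longrightarrow> f x = g x" "Ck_on k S f"
  shows "Ck_on k S g"
  using assms(2,3)
proof (induction k arbitrary: f g)
  case 0
  then show ?case by (auto cong: continuous_on_cong)
next
  case (Suc k)
  have "g differentiable (at x)" if "x \<in> S" for x
    using Suc.prems that by (auto intro: differentiable_cong_open[OF assms(1)])
  moreover have "Ck_on k S (\<lambda>x. frechet_derivative g (at x) v)" for v
  proof (rule Suc.IH)
    show "Ck_on k S (\<lambda>x. frechet_derivative f (at x) v)"
      using Suc.prems by simp
    show "frechet_derivative f (at x) v = frechet_derivative g (at x) v" if "x \<in> S" for x
      using frechet_derivative_cong_open[OF assms(1) that, of f g] Suc.prems(1) by simp
  qed
  ultimately show ?case by simp
qed

lemma Ck_on_SucD: "Ck_on (Suc k) S f \<Longrightarrow> Ck_on k S f"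
proof (induction k arbitrary: f)
  case 0
  then show ?case
    by (auto intro!: continuous_at_imp_continuous_on differentiable_imp_continuous_within)
next
  case (Suc k)
  show ?case
    using Suc.IH Suc.prems by (metis Ck_on.simps(2))
qed

section \<open>Closure of C^k maps under sums, products and composition\<close>

lemma Ck_on_const [simp]: "Ck_on k S (\<lambda>x. c)"
  by (induction k arbitrary: c) simp_all

lemma Ck_on_add:
  assumes "open S" "Ck_on k S f" "Ck_on k S g"
  shows "Ck_on k S (\<lambda>x. f x + g x)"
  using assms(2,3)
proof (induction k arbitrary: f g)
  case 0
  then show ?case by (simp add: continuous_on_add)
next
  case (Suc k)
  have "Ck_on k S (\<lambda>x. frechet_derivative (\<lambda>x. f x + g x) (at x) v)" for v
  proof (rule Ck_on_cong[OF assms(1)])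
    show "Ck_on k S (\<lambda>x. frechet_derivative f (at x) v + frechet_derivative g (at x) v)"
      using Suc by simp
    show "frechet_derivative f (at x) v + frechet_derivative g (at x) v =
        frechet_derivative (\<lambda>x. f x + g x) (at x) v" if "x \<in> S" for x
    proof -
      have "((\<lambda>x. f x + g x) has_derivative
          (\<lambda>v. frechet_derivative f (at x) v + frechet_derivative g (at x) v)) (at x)"
        using Suc.prems that by (intro has_derivative_add has_frechet_derivative) auto
      from frechet_derivative_at[OF this] show ?thesis by metis
    qed
  qed
  then show ?case
    using Suc.prems by (auto intro: differentiable_add)
qed

text \<open>The product rule drives the induction. Its undifferentiated factors have one order of
  regularity to spare, which \<open>Ck_on_SucD\<close> drops. The bilinear form covers both scalar
  multiplication and the inner product.\<close>

lemma (in bounded_bilinear) Ck_on_prod: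
  assumes "open S" "Ck_on k S f" "Ck_on k S g"
  shows "Ck_on k S (\<lambda>x. prod (f x) (g x))"
  using assms(2,3)
proof (induction k arbitrary: f g)
  case 0
  then show ?case by (simp add: continuous_on)
next
  case (Suc k)
  have der: "((\<lambda>x. prod (f x) (g x)) has_derivative
      (\<lambda>v. prod (f x) (frechet_derivative g (at x) v) + prod (frechet_derivative f (at x) v) (g x)))
      (at x)" if "x \<in> S" for x
    using Suc.prems that by (intro FDERIV has_frechet_derivative) auto
  have "Ck_on k S (\<lambda>x. frechet_derivative (\<lambda>x. prod (f x) (g x)) (at x) v)" for v
  proof (rule Ck_on_cong[OF assms(1)])
    show "Ck_on k S (\<lambda>x. prod (f x) (frechet_derivative g (at x) v) +
        prod (frechet_derivative f (at x) v) (g x))"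
      using Suc.prems Ck_on_SucD[OF Suc.prems(1)] Ck_on_SucD[OF Suc.prems(2)]
      by (intro Ck_on_add[OF assms(1)] Suc.IH) auto
    show "prod (f x) (frechet_derivative g (at x) v) + prod (frechet_derivative f (at x) v) (g x) =
        frechet_derivative (\<lambda>x. prod (f x) (g x)) (at x) v" if "x \<in> S" for x
      using frechet_derivative_at[OF der[OF that]] by metis
  qed
  then show ?case
    using der by (auto simp: differentiable_def)
qed

lemma Ck_on_sum:
  assumes "open S" "\<And>b. b \<in> B \<Longrightarrow> Ck_on k S (f b)"
  shows "Ck_on k S (\<lambda>x. \<Sum>b\<in>B. f b x)"
  using assms(2)
  by (induction B rule: infinite_finite_induct) (auto intro: Ck_on_add[OF assms(1)])

lemma linear_sum_Basis:
  fixes L :: "'a::euclidean_space \<Rightarrow> 'b::real_vector"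
  assumes "linear L"
  shows "L v = (\<Sum>b\<in>Basis. (v \<bullet> b) *\<^sub>R L b)"
proof -
  have "L v = L (\<Sum>b\<in>Basis. (v \<bullet> b) *\<^sub>R b)"
    by (simp add: euclidean_representation)
  also have "\<dots> = (\<Sum>b\<in>Basis. (v \<bullet> b) *\<^sub>R L b)"
    using assms by (simp add: linear_sum linear_scale)
  finally show ?thesis .
qed

text \<open>In the chain rule the derivative of \<open>f\<close> is taken in a direction depending
  on \<open>x\<close>, whereas \<open>Ck_on\<close> only speaks of fixed directions. Expanding that
  direction in the basis of the Euclidean middle space reduces it to products and compositions of
  lower order.\<close>

lemma Ck_on_compose:
  fixes g :: "'a::real_normed_vector \<Rightarrow> 'b::euclidean_space"
  assumes "open S" "g ` S \<subseteq> T" "Ck_on k T f" "Ck_on k S g"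
  shows "Ck_on k S (\<lambda>x. f (g x))"
  using assms(3,4)
proof (induction k arbitrary: f)
  case 0
  then show ?case
    using assms(2) by (auto intro: continuous_on_compose2)
next
  case (Suc k)
  have diff: "f differentiable (at (g x))" "g differentiable (at x)" if "x \<in> S" for x
    using Suc.prems that assms(2) by auto
  have "Ck_on k S (\<lambda>x. frechet_derivative (\<lambda>x. f (g x)) (at x) v)" for v
  proof (rule Ck_on_cong[OF assms(1)])
    show "Ck_on k S (\<lambda>x. \<Sum>b\<in>Basis.
        (frechet_derivative g (at x) v \<bullet> b) *\<^sub>R frechet_derivative f (at (g x)) b)"
      using Suc.prems Ck_on_SucD[OF Suc.prems(2)]
      by (intro Ck_on_sum assms(1) bounded_bilinear.Ck_on_prod[OF bounded_bilinear_scaleR]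
          bounded_bilinear.Ck_on_prod[OF bounded_bilinear_inner] Suc.IH Ck_on_const) auto
    show "(\<Sum>b\<in>Basis. (frechet_derivative g (at x) v \<bullet> b) *\<^sub>R frechet_derivative f (at (g x)) b) =
        frechet_derivative (\<lambda>x. f (g x)) (at x) v" if "x \<in> S" for x
      using diff[OF that] frechet_derivative_compose_apply[of f g x v]
        linear_sum_Basis[OF linear_frechet_derivative[OF diff(1)[OF that]], symmetric] by simp
  qed
  moreover have "(\<lambda>x. f (g x)) differentiable (at x)" if "x \<in> S" for x
    using differentiable_chain_at[of g x f] diff[OF that] by (simp add: o_def)
  ultimately show ?case by simp
qed

section \<open>The same closure properties for smooth maps\<close>

lemma smooth_on_subset: "smooth_on S f \<Longrightarrow> T \<subseteq> S \<Longrightarrow> smooth_on T f"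
  unfolding smooth_on_def by (blast intro: Ck_on_subset)

lemma smooth_on_cong:
  "open S \<Longrightarrow> (\<And>x. x \<in> S \<Longrightarrow> f x = g x) \<Longrightarrow> smooth_on S f \<Longrightarrow> smooth_on S g"
  unfolding smooth_on_def by (blast intro: Ck_on_cong)

lemma smooth_on_const [simp]: "smooth_on S (\<lambda>x. c)"
  by (simp add: smooth_on_def)

lemma smooth_on_sum:
  "open S \<Longrightarrow> (\<And>b. b \<in> B \<Longrightarrow> smooth_on S (f b)) \<Longrightarrow> smooth_on S (\<lambda>x. \<Sum>b\<in>B. f b x)"
  unfolding smooth_on_def by (blast intro: Ck_on_sum)

lemma smooth_on_scaleR:
  "open S \<Longrightarrow> smooth_on S f \<Longrightarrow> smooth_on S g \<Longrightarrow> smooth_on S (\<lambda>x. f x *\<^sub>R g x)"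
  unfolding smooth_on_def by (blast intro: bounded_bilinear.Ck_on_prod[OF bounded_bilinear_scaleR])

lemma smooth_on_inner_const:
  "open S \<Longrightarrow> smooth_on S f \<Longrightarrow> smooth_on S (\<lambda>x. f x \<bullet> b)"
  unfolding smooth_on_def
  using bounded_bilinear.Ck_on_prod[OF bounded_bilinear_inner, of S _ f "\<lambda>_. b"] by simp

lemma smooth_on_compose:
  fixes g :: "'a::real_normed_vector \<Rightarrow> 'b::euclidean_space"
  shows "open S \<Longrightarrow> g ` S \<subseteq> T \<Longrightarrow> smooth_on T f \<Longrightarrow> smooth_on S g \<Longrightarrow> smooth_on S (\<lambda>x. f (g x))"
  unfolding smooth_on_def by (blast intro: Ck_on_compose)

lemma smooth_on_imp_differentiable:
  assumes "smooth_on S f" "x \<in> S"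
  shows "f differentiable (at x)"
proof -
  have "Ck_on (Suc 0) S f"
    using assms(1) unfolding smooth_on_def by blast
  then show ?thesis
    using assms(2) by simp
qed

lemma smooth_on_frechet_derivative:
  assumes "smooth_on S f"
  shows "smooth_on S (\<lambda>x. frechet_derivative f (at x) v)"
  unfolding smooth_on_def
proof
  fix k
  have "Ck_on (Suc k) S f"
    using assms unfolding smooth_on_def by blast
  then show "Ck_on k S (\<lambda>x. frechet_derivative f (at x) v)"
    by simp
qed

text \<open>As for compositions, a varying direction \<open>g x\<close> is split into fixed basis
  directions with smooth coefficients.\<close>

lemma smooth_on_frechet_derivative_apply:
  fixes f :: "'a::euclidean_space \<Rightarrow> 'b::real_normed_vector"
  assumes "open S" "smooth_on S f" "smooth_on S g"
  shows "smooth_on S (\<lambda>x. frechet_derivative f (at x) (g x))"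
proof (rule smooth_on_cong[OF assms(1)])
  show "smooth_on S (\<lambda>x. \<Sum>b\<in>Basis. (g x \<bullet> b) *\<^sub>R frechet_derivative f (at x) b)"
    using assms by (intro smooth_on_sum smooth_on_scaleR smooth_on_inner_const
        smooth_on_frechet_derivative)
  show "(\<Sum>b\<in>Basis. (g x \<bullet> b) *\<^sub>R frechet_derivative f (at x) b) =
      frechet_derivative f (at x) (g x)" if "x \<in> S" for x
    using linear_sum_Basis[OF linear_frechet_derivative
        [OF smooth_on_imp_differentiable[OF assms(2) that]], symmetric] by simp
qed


section \<open>Charts and coordinate frames\<close>

lemma is_chart_cinv_cmap:
  assumes "is_chart c" "q \<in> cdom c"
  shows "cinv c (cmap c q) = q"
  using assms unfolding is_chart_def homeomorphism_def by blast

text \<open>A homeomorphism is open onto its image, and the image of a chart is itself open in the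
  model space.\<close>

lemma open_cmap_image:
  assumes "is_chart c" "open W"
  shows "open (cmap c ` (W \<inter> cdom c))"
proof -
  have "openin (top_of_set (cmap c ` cdom c)) (cmap c ` (W \<inter> cdom c))"
  proof (rule homeomorphism_imp_open_map)
    show "homeomorphism (cdom c) (cmap c ` cdom c) (cmap c) (cinv c)"
      using assms(1) by (simp add: is_chart_def)
    show "openin (top_of_set (cdom c)) (W \<inter> cdom c)"
      using assms(2) by (auto simp: openin_open)
  qed
  then show ?thesis
    using assms(1) by (simp add: is_chart_def openin_open_eq)
qed

lemma smooth_atlas_is_chart: "smooth_atlas M \<Longrightarrow> c \<in> M \<Longrightarrow> is_chart c"
  by (simp add: smooth_atlas_def)

lemma chart_at:
  assumes "smooth_atlas M"
  shows "chart_at M p \<in> M" "p \<in> cdom (chart_at M p)"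
proof -
  obtain c where "c \<in> M \<and> p \<in> cdom c"
    using assms unfolding smooth_atlas_def by blast
  then have "chart_at M p \<in> M \<and> p \<in> cdom (chart_at M p)"
    unfolding chart_at_def by (rule someI)
  then show "chart_at M p \<in> M" "p \<in> cdom (chart_at M p)" by auto
qed

text \<open>Near \<open>x\<close> the map \<open>F \<circ> h\<close> factors through the chart as
  \<open>(F \<circ> cinv c) \<circ> (cmap c \<circ> h)\<close>, so the Euclidean chain rule applies.
  Both coordinate changes and pull-backs along \<open>\<iota>\<close> are instances, by the choice
  of \<open>h\<close>.\<close>

lemma frechet_derivative_via_chart:
  assumes "is_chart c" "open S" "x \<in> S" "h ` S \<subseteq> cdom c"
    and "(cmap c \<circ> h) differentiable (at x)"
    and "(F \<circ> cinv c) differentiable (at (cmap c (h x)))"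
  shows "frechet_derivative (F \<circ> h) (at x) v =
    frechet_derivative (F \<circ> cinv c) (at (cmap c (h x))) (frechet_derivative (cmap c \<circ> h) (at x) v)"
    and "(F \<circ> h) differentiable (at x)"
proof -
  have eq: "((F \<circ> cinv c) \<circ> (cmap c \<circ> h)) y = (F \<circ> h) y" if "y \<in> S" for y
  proof -
    have "h y \<in> cdom c"
      using that assms(4) by auto
    then show ?thesis
      by (simp add: is_chart_cinv_cmap[OF assms(1)])
  qed
  have "frechet_derivative ((F \<circ> cinv c) \<circ> (cmap c \<circ> h)) (at x) v =
      frechet_derivative (F \<circ> cinv c) (at (cmap c (h x))) (frechet_derivative (cmap c \<circ> h) (at x) v)"
    using frechet_derivative_compose[OF assms(5), of "F \<circ> cinv c"] assms(6) by simp
  moreover have "frechet_derivative ((F \<circ> cinv c) \<circ> (cmap c \<circ> h)) (at x) =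
      frechet_derivative (F \<circ> h) (at x)"
    using assms(2,3) eq by (rule frechet_derivative_cong_open)
  ultimately show "frechet_derivative (F \<circ> h) (at x) v =
    frechet_derivative (F \<circ> cinv c) (at (cmap c (h x))) (frechet_derivative (cmap c \<circ> h) (at x) v)"
    by (simp only:)
  have "((F \<circ> cinv c) \<circ> (cmap c \<circ> h)) differentiable (at x)"
    using assms(5,6) by (intro differentiable_chain_at) auto
  with assms(2,3) eq show "(F \<circ> h) differentiable (at x)"
    by (rule differentiable_cong_open)
qed

section \<open>Changes of coordinates\<close>

lemma transition_smooth_on:
  assumes "smooth_atlas M" "c \<in> M" "d \<in> M"
  shows "smooth_on (cmap c ` (cdom c \<inter> cdom d)) (cmap d \<circ> cinv c)"
  using assms by (simp add: smooth_atlas_def)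

lemma transition_differentiable:
  assumes "smooth_atlas M" "c \<in> M" "d \<in> M" "q \<in> cdom c" "q \<in> cdom d"
  shows "(cmap d \<circ> cinv c) differentiable (at (cmap c q))"
  using transition_smooth_on[OF assms(1-3)] assms(4,5)
  by (auto intro: smooth_on_imp_differentiable)

lemma open_chart_overlap:
  assumes "smooth_atlas M" "c \<in> M" "d \<in> M"
  shows "open (cmap c ` (cdom c \<inter> cdom d))"
proof -
  have "open (cdom d)"
    using assms by (simp add: smooth_atlas_def is_chart_def)
  from open_cmap_image[OF smooth_atlas_is_chart[OF assms(1,2)] this] show ?thesis
    by (simp add: Int_commute)
qed

text \<open>This is \<open>frechet_derivative_via_chart\<close> with \<open>h = cinv c\<close>; the
  factorization is valid on the overlap of the two charts.\<close>

lemma frechet_derivative_transition: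
  assumes "smooth_atlas M" "c \<in> M" "d \<in> M" "q \<in> cdom c" "q \<in> cdom d"
    and "(F \<circ> cinv d) differentiable (at (cmap d q))"
  shows "frechet_derivative (F \<circ> cinv c) (at (cmap c q)) v =
    frechet_derivative (F \<circ> cinv d) (at (cmap d q))
      (frechet_derivative (cmap d \<circ> cinv c) (at (cmap c q)) v)"
proof -
  note inv = is_chart_cinv_cmap[OF smooth_atlas_is_chart[OF assms(1,2)]]
  have q: "cinv c (cmap c q) = q"
    by (rule inv[OF assms(4)])
  have "frechet_derivative (F \<circ> cinv c) (at (cmap c q)) v =
    frechet_derivative (F \<circ> cinv d) (at (cmap d (cinv c (cmap c q))))
      (frechet_derivative (cmap d \<circ> cinv c) (at (cmap c q)) v)"
  proof (rule frechet_derivative_via_chart(1))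
    show "is_chart d"
      by (rule smooth_atlas_is_chart[OF assms(1,3)])
    show "open (cmap c ` (cdom c \<inter> cdom d))"
      by (rule open_chart_overlap[OF assms(1-3)])
    show "cinv c ` (cmap c ` (cdom c \<inter> cdom d)) \<subseteq> cdom d"
      using inv by auto
    show "(cmap d \<circ> cinv c) differentiable (at (cmap c q))"
      by (rule transition_differentiable[OF assms(1-5)])
  qed (use assms q in auto)
  then show ?thesis
    by (simp only: q)
qed

lemma frechet_derivative_chart_self:
  assumes "smooth_atlas M" "c \<in> M" "q \<in> cdom c"
  shows "frechet_derivative (cmap c \<circ> cinv c) (at (cmap c q)) v = v"
proof -
  have "frechet_derivative (cmap c \<circ> cinv c) (at (cmap c q)) =
      frechet_derivative (\<lambda>y. y) (at (cmap c q))"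
    using open_chart_overlap[OF assms(1,2,2)] assms(3)
      is_chart_cinv_cmap[OF smooth_atlas_is_chart[OF assms(1,2)]]
    by (intro frechet_derivative_cong_open) auto
  then show ?thesis
    by (simp add: frechet_derivative_ident)
qed

section \<open>Components of tangent vectors and coordinate frames\<close>

lemma linear_coords:
  assumes "smooth_atlas M" "c \<in> M" "q \<in> cdom c"
  shows "linear (coords M c q)"
proof -
  have "coords M c q =
      frechet_derivative (cmap c \<circ> cinv (chart_at M q)) (at (cmap (chart_at M q) q))"
    by (simp add: coords_def fun_eq_iff)
  then show ?thesis
    by (simp only:) (intro linear_frechet_derivative transition_differentiable[OF assms(1)]
        chart_at[OF assms(1)] assms)
qed

text \<open>Both sides of the composition refer to the arbitrary preferred chart at
  \<open>q\<close>; the chain rule eliminates it and leaves the Jacobian of the transition from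
  \<open>c\<close> to \<open>d\<close>.\<close>

lemma coords_coord_field:
  assumes "smooth_atlas M" "c \<in> M" "d \<in> M" "q \<in> cdom c" "q \<in> cdom d"
  shows "coords M d q (coord_field M c e q) =
    frechet_derivative (cmap d \<circ> cinv c) (at (cmap c q)) e"
  unfolding coords_def coord_field_def
  by (intro frechet_derivative_transition[OF assms(1), symmetric] transition_differentiable[OF assms(1)]
      chart_at[OF assms(1)] assms)

lemma coord_field_coords:
  assumes "smooth_atlas M" "c \<in> M" "q \<in> cdom c"
  shows "coord_field M c (coords M c q v) q = v"
proof -
  note a = chart_at[OF assms(1), of q]
  have "coord_field M c (coords M c q v) q =
      frechet_derivative (cmap (chart_at M q) \<circ> cinv (chart_at M q)) (at (cmap (chart_at M q) q)) v"
    unfolding coords_def coord_field_def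
    by (intro frechet_derivative_transition[OF assms(1), symmetric] transition_differentiable[OF assms(1)]
        a assms)
  then show ?thesis
    using frechet_derivative_chart_self[OF assms(1) a] by simp
qed

lemma linear_coord_field:
  assumes "smooth_atlas M" "c \<in> M" "q \<in> cdom c"
  shows "linear (\<lambda>e. coord_field M c e q)"
  unfolding coord_field_def
  by (intro linear_frechet_derivative transition_differentiable[OF assms(1)]
      chart_at[OF assms(1)] assms)

lemma frame_expansion:
  assumes "smooth_atlas M" "c \<in> M" "q \<in> cdom c"
  shows "(\<Sum>b\<in>Basis. (coords M c q v \<bullet> b) *\<^sub>R coord_field M c b q) = v"
  by (metis linear_sum_Basis[OF linear_coord_field[OF assms]] coord_field_coords[OF assms])

text \<open>Precomposition with the smooth transition from \<open>d\<close> to \<open>c\<close>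
  shows that smoothness over a subset of \<open>cdom c\<close> can be checked in the single chart
  \<open>c\<close>.\<close>

lemma smooth_on_cmap_image:
  assumes "smooth_atlas M" "c \<in> M" "d \<in> M" "open W" "W \<subseteq> cdom c"
    and "smooth_on (cmap c ` W) f"
  shows "smooth_on (cmap d ` (W \<inter> cdom d)) (\<lambda>y. f (cmap c (cinv d y)))"
proof (rule smooth_on_compose[where T = "cmap c ` W"])
  note d = smooth_atlas_is_chart[OF assms(1,3)]
  show "open (cmap d ` (W \<inter> cdom d))"
    by (rule open_cmap_image[OF d assms(4)])
  show "(\<lambda>y. cmap c (cinv d y)) ` (cmap d ` (W \<inter> cdom d)) \<subseteq> cmap c ` W"
    using is_chart_cinv_cmap[OF d] by auto
  show "smooth_on (cmap d ` (W \<inter> cdom d)) (\<lambda>y. cmap c (cinv d y))"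
    using smooth_on_subset[OF transition_smooth_on[OF assms(1,3,2)],
        of "cmap d ` (W \<inter> cdom d)"] assms(5) by (auto simp: o_def)
  show "smooth_on (cmap c ` W) f" by fact
qed

text \<open>By \<open>coords_coord_field\<close> the components in a chart \<open>d\<close> are
  derivatives of a transition map. These are smooth in the coordinates of \<open>c\<close>, hence
  also in those of \<open>d\<close>.\<close>

lemma vector_field_coord_field:
  assumes "smooth_atlas M" "c \<in> M"
  shows "vector_field M (cdom c) (coord_field M c e)"
  unfolding vector_field_def
proof
  fix d assume d: "d \<in> M"
  have ov: "open (cdom c \<inter> cdom d)"
    using smooth_atlas_is_chart[OF assms] smooth_atlas_is_chart[OF assms(1) d]
    by (auto simp: is_chart_def)
  have "smooth_on (cmap c ` (cdom c \<inter> cdom d))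
      (\<lambda>y. frechet_derivative (cmap d \<circ> cinv c) (at y) e)"
    by (rule smooth_on_frechet_derivative[OF transition_smooth_on[OF assms d]])
  from smooth_on_cmap_image[OF assms d ov _ this]
  have sm: "smooth_on (cmap d ` (cdom c \<inter> cdom d))
      (\<lambda>y. frechet_derivative (cmap d \<circ> cinv c) (at (cmap c (cinv d y))) e)"
    by (simp add: Int_assoc)
  show "smooth_on (cmap d ` (cdom c \<inter> cdom d))
      ((\<lambda>p. coords M d p (coord_field M c e p)) \<circ> cinv d)"
  proof (rule smooth_on_cong[OF _ _ sm])
    show "open (cmap d ` (cdom c \<inter> cdom d))"
      using open_chart_overlap[OF assms(1) d assms(2)] by (simp add: Int_commute)
    show "frechet_derivative (cmap d \<circ> cinv c) (at (cmap c (cinv d y))) e =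
        ((\<lambda>p. coords M d p (coord_field M c e p)) \<circ> cinv d) y"
      if "y \<in> cmap d ` (cdom c \<inter> cdom d)" for y
      using that coords_coord_field[OF assms d]
        is_chart_cinv_cmap[OF smooth_atlas_is_chart[OF assms(1) d]] by auto
  qed
qed

section \<open>Operations on smooth fields\<close>

lemma vector_field_subset: "vector_field M U X \<Longrightarrow> W \<subseteq> U \<Longrightarrow> vector_field M W X"
  unfolding vector_field_def by (blast intro: smooth_on_subset)

lemma smooth_fun_coords:
  assumes "smooth_atlas M" "c \<in> M" "open W" "W \<subseteq> cdom c" "vector_field M W X"
  shows "smooth_fun M W (\<lambda>q. coords M c q (X q) \<bullet> b)"
  unfolding smooth_fun_def
proof
  fix d assume d: "d \<in> M"
  note dc = smooth_atlas_is_chart[OF assms(1) d] and cc = smooth_atlas_is_chart[OF assms(1,2)]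
  have W: "W \<inter> cdom c = W"
    using assms(4) by blast
  have op: "open (cmap c ` W)"
    using open_cmap_image[OF cc assms(3)] W by simp
  have "smooth_on (cmap c ` W) ((\<lambda>q. coords M c q (X q)) \<circ> cinv c)"
    using assms(2,5) W unfolding vector_field_def by metis
  then have "smooth_on (cmap c ` W) (\<lambda>y. coords M c (cinv c y) (X (cinv c y)) \<bullet> b)"
    using smooth_on_inner_const[OF op] by (simp add: o_def)
  from smooth_on_cmap_image[OF assms(1,2) d assms(3,4) this]
  show "smooth_on (cmap d ` (W \<inter> cdom d)) ((\<lambda>q. coords M c q (X q) \<bullet> b) \<circ> cinv d)"
  proof (rule smooth_on_cong[rotated 2])
    show "open (cmap d ` (W \<inter> cdom d))"
      by (rule open_cmap_image[OF dc assms(3)])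
    show "coords M c (cinv c (cmap c (cinv d y))) (X (cinv c (cmap c (cinv d y)))) \<bullet> b =
        ((\<lambda>q. coords M c q (X q) \<bullet> b) \<circ> cinv d) y" if "y \<in> cmap d ` (W \<inter> cdom d)" for y
      using that is_chart_cinv_cmap[OF dc] is_chart_cinv_cmap[OF cc] assms(4) by auto
  qed
qed

lemma vector_field_scaleR:
  assumes "smooth_atlas M" "open W" "smooth_fun M W f" "vector_field M W X"
  shows "vector_field M W (\<lambda>q. f q *\<^sub>R X q)"
  unfolding vector_field_def
proof
  fix c assume c: "c \<in> M"
  note cc = smooth_atlas_is_chart[OF assms(1) c]
  have op: "open (cmap c ` (W \<inter> cdom c))"
    by (rule open_cmap_image[OF cc assms(2)])
  show "smooth_on (cmap c ` (W \<inter> cdom c)) ((\<lambda>p. coords M c p (f p *\<^sub>R X p)) \<circ> cinv c)"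
  proof (rule smooth_on_cong[OF op])
    show "smooth_on (cmap c ` (W \<inter> cdom c))
        (\<lambda>y. f (cinv c y) *\<^sub>R coords M c (cinv c y) (X (cinv c y)))"
      using assms(3,4) c unfolding smooth_fun_def vector_field_def o_def
      by (intro smooth_on_scaleR op) auto
    show "f (cinv c y) *\<^sub>R coords M c (cinv c y) (X (cinv c y)) =
        ((\<lambda>p. coords M c p (f p *\<^sub>R X p)) \<circ> cinv c) y" if "y \<in> cmap c ` (W \<inter> cdom c)" for y
      using that is_chart_cinv_cmap[OF cc] linear_scale[OF linear_coords[OF assms(1) c]] by auto
  qed
qed

lemma vector_field_sum:
  assumes "smooth_atlas M" "open W" "\<And>b. b \<in> B \<Longrightarrow> vector_field M W (X b)"
  shows "vector_field M W (\<lambda>q. \<Sum>b\<in>B. X b q)"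
  unfolding vector_field_def
proof
  fix c assume c: "c \<in> M"
  note cc = smooth_atlas_is_chart[OF assms(1) c]
  have op: "open (cmap c ` (W \<inter> cdom c))"
    by (rule open_cmap_image[OF cc assms(2)])
  show "smooth_on (cmap c ` (W \<inter> cdom c)) ((\<lambda>p. coords M c p (\<Sum>b\<in>B. X b p)) \<circ> cinv c)"
  proof (rule smooth_on_cong[OF op])
    show "smooth_on (cmap c ` (W \<inter> cdom c))
        (\<lambda>y. \<Sum>b\<in>B. coords M c (cinv c y) (X b (cinv c y)))"
      using assms(3) c unfolding vector_field_def o_def
      by (intro smooth_on_sum op) auto
    show "(\<Sum>b\<in>B. coords M c (cinv c y) (X b (cinv c y))) =
        ((\<lambda>p. coords M c p (\<Sum>b\<in>B. X b p)) \<circ> cinv c) y" if "y \<in> cmap c ` (W \<inter> cdom c)" for y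
      using that by (auto simp: is_chart_cinv_cmap[OF cc] linear_sum[OF linear_coords[OF assms(1) c]])
  qed
qed


section \<open>Directional derivatives and connections\<close>

lemma dir_deriv_cong:
  assumes "smooth_atlas M" "open W" "p \<in> W" "\<And>q. q \<in> W \<Longrightarrow> f q = g q"
  shows "dir_deriv M p u f = dir_deriv M p u g"
proof -
  let ?c = "chart_at M p"
  note c = smooth_atlas_is_chart[OF assms(1) chart_at(1)[OF assms(1), of p]]
  have "frechet_derivative (f \<circ> cinv ?c) (at (cmap ?c p)) =
      frechet_derivative (g \<circ> cinv ?c) (at (cmap ?c p))"
  proof (rule frechet_derivative_cong_open[OF open_cmap_image[OF c assms(2)]])
    show "cmap ?c p \<in> cmap ?c ` (W \<inter> cdom ?c)"
      using chart_at(2)[OF assms(1), of p] assms(3) by blast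
    show "(f \<circ> cinv ?c) y = (g \<circ> cinv ?c) y" if "y \<in> cmap ?c ` (W \<inter> cdom ?c)" for y
      using that by (auto simp: is_chart_cinv_cmap[OF c] assms(4))
  qed
  then show ?thesis
    by (simp add: dir_deriv_def)
qed

lemma dir_deriv_const: "dir_deriv M p u (\<lambda>q. r) = 0"
  by (simp add: dir_deriv_def o_def)

text \<open>The product rule in the shape of a matrix row times a vector, as needed for the
  components of an endomorphism applied to a field.\<close>

lemma dir_deriv_sum_mult:
  assumes "smooth_atlas M"
    and f: "\<And>b. b \<in> B \<Longrightarrow> (f b \<circ> cinv (chart_at M p)) differentiable (at (cmap (chart_at M p) p))"
    and g: "\<And>b. b \<in> B \<Longrightarrow> (g b \<circ> cinv (chart_at M p)) differentiable (at (cmap (chart_at M p) p))"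
  shows "dir_deriv M p u (\<lambda>q. \<Sum>b\<in>B. f b q * g b q) =
    (\<Sum>b\<in>B. f b p * dir_deriv M p u (g b) + dir_deriv M p u (f b) * g b p)"
proof -
  let ?c = "chart_at M p"
  have p: "cinv ?c (cmap ?c p) = p"
    by (intro is_chart_cinv_cmap smooth_atlas_is_chart[OF assms(1)] chart_at[OF assms(1)])
  have "((\<lambda>y. \<Sum>b\<in>B. (f b \<circ> cinv ?c) y * (g b \<circ> cinv ?c) y) has_derivative
    (\<lambda>u. \<Sum>b\<in>B. (f b \<circ> cinv ?c) (cmap ?c p) * dir_deriv M p u (g b)
        + dir_deriv M p u (f b) * (g b \<circ> cinv ?c) (cmap ?c p))) (at (cmap ?c p))"
    unfolding dir_deriv_def
    by (intro has_derivative_sum has_derivative_mult has_frechet_derivative f g)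
  from fun_cong[OF frechet_derivative_at[OF this], of u, symmetric] show ?thesis
    unfolding dir_deriv_def[of M p u "\<lambda>q. \<Sum>b\<in>B. f b q * g b q"] by (simp add: o_def p)
qed

lemma vector_field_nearI: "open W \<Longrightarrow> p \<in> W \<Longrightarrow> vector_field M W X \<Longrightarrow> vector_field_near M p X"
  unfolding vector_field_near_def by blast

lemma smooth_fun_nearI: "open W \<Longrightarrow> p \<in> W \<Longrightarrow> smooth_fun M W f \<Longrightarrow> smooth_fun_near M p f"
  unfolding smooth_fun_near_def by blast

lemma vector_field_near_coord_field:
  assumes "smooth_atlas M" "c \<in> M" "p \<in> cdom c"
  shows "vector_field_near M p (coord_field M c e)"
proof (rule vector_field_nearI)
  show "open (cdom c)"
    using smooth_atlas_is_chart[OF assms(1,2)] by (simp add: is_chart_def)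
  show "vector_field M (cdom c) (coord_field M c e)"
    by (rule vector_field_coord_field[OF assms(1,2)])
qed fact

lemma smooth_fun_imp_differentiable:
  assumes "smooth_fun M W f" "p \<in> W" "c \<in> M" "p \<in> cdom c"
  shows "(f \<circ> cinv c) differentiable (at (cmap c p))"
  using assms unfolding smooth_fun_def by (blast intro: smooth_on_imp_differentiable)

section \<open>Locality and additivity of connections\<close>

lemma connection_on_add:
  assumes "connection_on M U D" "p \<in> U" "vector_field_near M p X" "vector_field_near M p Y"
  shows "D p u (\<lambda>q. X q + Y q) = D p u X + D p u Y"
  using assms(1)[unfolded connection_on_def, THEN conjunct2, THEN conjunct1, rule_format,
      OF assms(2) conjI[OF assms(3,4)]] .

lemma connection_on_scaleR:
  assumes "connection_on M U D" "p \<in> U" "smooth_fun_near M p f" "vector_field_near M p X"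
  shows "D p u (\<lambda>q. f q *\<^sub>R X q) = dir_deriv M p u f *\<^sub>R X p + f p *\<^sub>R D p u X"
  using assms(1)[unfolded connection_on_def, THEN conjunct2, THEN conjunct2, THEN conjunct1,
      rule_format, OF assms(2) conjI[OF assms(3,4)]] .

text \<open>The Leibniz rule for the indicator function of \<open>W\<close> localizes the connection.\<close>

lemma connection_on_cong:
  assumes "smooth_atlas M" "connection_on M U D" "p \<in> U"
    and "vector_field_near M p X" "vector_field_near M p Y"
    and "open W" "p \<in> W" "\<And>q. q \<in> W \<Longrightarrow> X q = Y q"
  shows "D p u X = D p u Y"
proof -
  define f :: "'a \<Rightarrow> real" where "f = (\<lambda>q. if q \<in> W then 1 else 0)"
  have "smooth_fun M W f"
    unfolding smooth_fun_def
  proof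
    fix c assume c: "c \<in> M"
    note cc = smooth_atlas_is_chart[OF assms(1) c]
    show "smooth_on (cmap c ` (W \<inter> cdom c)) (f \<circ> cinv c)"
      by (rule smooth_on_cong[OF open_cmap_image[OF cc assms(6)] _ smooth_on_const[of _ 1]])
        (auto simp: f_def is_chart_cinv_cmap[OF cc])
  qed
  then have f: "smooth_fun_near M p f"
    by (rule smooth_fun_nearI[OF assms(6,7)])
  \<comment> \<open>Near \<open>p\<close> the indicator is constantly 1, so the derivative term of
    the Leibniz rule drops out.\<close>
  have df: "dir_deriv M p u f = 0"
    using dir_deriv_cong[OF assms(1,6,7), of f "\<lambda>_. 1"] by (simp add: f_def dir_deriv_const)
  have loc: "D p u (\<lambda>q. f q *\<^sub>R Z q) = D p u Z" if "vector_field_near M p Z" for Z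
    using connection_on_scaleR[OF assms(2,3) f that] df assms(7) by (simp add: f_def)
  \<comment> \<open>The truncated fields agree on all of the manifold, not only on \<open>W\<close>,
    so they are the same argument of \<open>D\<close>.\<close>
  have "(\<lambda>q. f q *\<^sub>R X q) = (\<lambda>q. f q *\<^sub>R Y q)"
    using assms(8) by (auto simp: f_def)
  then show ?thesis
    using loc[OF assms(4)] loc[OF assms(5)] by simp
qed

lemma connection_on_sum:
  assumes "smooth_atlas M" "connection_on M U D" "p \<in> U" "open W" "p \<in> W" "finite B"
    and "\<And>b. b \<in> B \<Longrightarrow> vector_field M W (X b)"
  shows "D p u (\<lambda>q. \<Sum>b\<in>B. X b q) = (\<Sum>b\<in>B. D p u (X b))"
  using assms(6,7)
proof (induction B)
  case empty
  have "vector_field_near M p (\<lambda>q. \<Sum>b\<in>{}. X b q)"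
    using vector_field_sum[OF assms(1,4), of "{}"] by (intro vector_field_nearI[OF assms(4,5)]) auto
  \<comment> \<open>Additivity for the zero field, written as 0 + 0, forces its derivative to
    vanish.\<close>
  from connection_on_add[OF assms(2,3) this this] show ?case
    by simp
next
  case (insert b B)
  have "vector_field_near M p (X b)" "vector_field_near M p (\<lambda>q. \<Sum>b\<in>B. X b q)"
    using insert.prems
    by (auto intro!: vector_field_nearI[OF assms(4,5)] vector_field_sum[OF assms(1,4)])
  from connection_on_add[OF assms(2,3) this] show ?case
    using insert by simp
qed


section \<open>Differentiation along a map\<close>

lemma open_chart_vimage:
  assumes "smooth_atlas N" "smooth_atlas M" "smooth_map N M \<iota>" "d \<in> N" "c \<in> M"
  shows "open (cdom d \<inter> \<iota> -` cdom c)" "open (cmap d ` (cdom d \<inter> \<iota> -` cdom c))"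
proof -
  have op: "open (\<iota> -` cdom c)"
    using assms smooth_atlas_is_chart[OF assms(2,5)]
    by (simp add: smooth_map_def is_chart_def continuous_on_open_vimage)
  then show "open (cdom d \<inter> \<iota> -` cdom c)"
    using smooth_atlas_is_chart[OF assms(1,4)] by (auto simp: is_chart_def)
  show "open (cmap d ` (cdom d \<inter> \<iota> -` cdom c))"
    using open_cmap_image[OF smooth_atlas_is_chart[OF assms(1,4)] op] by (simp add: Int_commute)
qed

lemma smooth_map_differentiable:
  assumes "smooth_map N M \<iota>" "d \<in> N" "c \<in> M" "z \<in> cdom d" "\<iota> z \<in> cdom c"
  shows "(cmap c \<circ> \<iota> \<circ> cinv d) differentiable (at (cmap d z))"
proof (rule smooth_on_imp_differentiable)
  show "smooth_on (cmap d ` (cdom d \<inter> \<iota> -` cdom c)) (cmap c \<circ> \<iota> \<circ> cinv d)"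
    using assms by (simp add: smooth_map_def)
qed (use assms in auto)

text \<open>This is \<open>frechet_derivative_via_chart\<close> with
  \<open>h = \<iota> \<circ> cinv d\<close>; continuity of \<open>\<iota>\<close> makes the domain
  of the factorization open.\<close>

lemma frechet_derivative_pullback:
  assumes "smooth_atlas N" "smooth_atlas M" "smooth_map N M \<iota>" "d \<in> N" "c \<in> M"
    and "z \<in> cdom d" "\<iota> z \<in> cdom c" "(F \<circ> cinv c) differentiable (at (cmap c (\<iota> z)))"
  shows "frechet_derivative (F \<circ> \<iota> \<circ> cinv d) (at (cmap d z)) v =
      frechet_derivative (F \<circ> cinv c) (at (cmap c (\<iota> z)))
        (frechet_derivative (cmap c \<circ> \<iota> \<circ> cinv d) (at (cmap d z)) v)"
    and "(F \<circ> \<iota> \<circ> cinv d) differentiable (at (cmap d z))"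
proof -
  note inv = is_chart_cinv_cmap[OF smooth_atlas_is_chart[OF assms(1,4)]]
  have hz: "(\<iota> \<circ> cinv d) (cmap d z) = \<iota> z"
    by (simp add: inv[OF assms(6)])
  have sub: "(\<iota> \<circ> cinv d) ` (cmap d ` (cdom d \<inter> \<iota> -` cdom c)) \<subseteq> cdom c"
    by (auto simp: inv)
  have z: "cmap d z \<in> cmap d ` (cdom d \<inter> \<iota> -` cdom c)"
    using assms(6,7) by blast
  note * = frechet_derivative_via_chart[OF smooth_atlas_is_chart[OF assms(2,5)]
      open_chart_vimage(2)[OF assms(1-5)] z sub]
  have d1: "(cmap c \<circ> (\<iota> \<circ> cinv d)) differentiable (at (cmap d z))"
    using smooth_map_differentiable[OF assms(3-7)] by (simp only: o_assoc)
  have d2: "(F \<circ> cinv c) differentiable (at (cmap c ((\<iota> \<circ> cinv d) (cmap d z))))"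
    using assms(8) by (simp only: hz)
  show "frechet_derivative (F \<circ> \<iota> \<circ> cinv d) (at (cmap d z)) v =
      frechet_derivative (F \<circ> cinv c) (at (cmap c (\<iota> z)))
        (frechet_derivative (cmap c \<circ> \<iota> \<circ> cinv d) (at (cmap d z)) v)"
    using *(1)[OF d1 d2, of v] by (simp only: hz o_assoc)
  show "(F \<circ> \<iota> \<circ> cinv d) differentiable (at (cmap d z))"
    using *(2)[OF d1 d2] by (simp only: o_assoc)
qed

lemma linear_differential:
  assumes "smooth_atlas N" "smooth_atlas M" "smooth_map N M \<iota>"
  shows "linear (differential N M \<iota> z)"
proof -
  have "differential N M \<iota> z = frechet_derivative (cmap (chart_at M (\<iota> z)) \<circ> \<iota> \<circ> cinv (chart_at N z))
       (at (cmap (chart_at N z) z))"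
    by (simp add: differential_def fun_eq_iff)
  then show ?thesis
    by (simp only:) (intro linear_frechet_derivative smooth_map_differentiable[OF assms(3)]
        chart_at assms)
qed

text \<open>\<open>differential\<close> is defined in the preferred charts. Changing coordinates on
  both sides makes it the Jacobian of \<open>\<iota>\<close> in arbitrary charts, where smoothness
  can be discussed.\<close>

lemma coords_differential:
  assumes "smooth_atlas N" "smooth_atlas M" "smooth_map N M \<iota>" "d \<in> N" "c \<in> M"
    and "z \<in> cdom d" "\<iota> z \<in> cdom c"
  shows "coords M c (\<iota> z) (differential N M \<iota> z v) =
    frechet_derivative (cmap c \<circ> \<iota> \<circ> cinv d) (at (cmap d z)) (coords N d z v)"
proof -
  note c0 = chart_at[OF assms(2), of "\<iota> z"] and d0 = chart_at[OF assms(1), of z]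
  have "coords M c (\<iota> z) (differential N M \<iota> z v) =
      frechet_derivative (cmap c \<circ> \<iota> \<circ> cinv (chart_at N z)) (at (cmap (chart_at N z) z)) v"
    unfolding coords_def differential_def
    by (rule frechet_derivative_pullback(1)[OF assms(1-3) d0(1) c0(1) d0(2) c0(2)
          transition_differentiable[OF assms(2) c0(1) assms(5) c0(2) assms(7)], symmetric])
  also have "\<dots> = frechet_derivative (cmap c \<circ> \<iota> \<circ> cinv d) (at (cmap d z)) (coords N d z v)"
    unfolding coords_def
    by (rule frechet_derivative_transition[OF assms(1) d0(1) assms(4) d0(2) assms(6)
          smooth_map_differentiable[OF assms(3-7)]])
  finally show ?thesis .
qed

lemma dir_deriv_pullback:
  assumes "smooth_atlas N" "smooth_atlas M" "smooth_map N M \<iota>"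
    and "(f \<circ> cinv (chart_at M (\<iota> z))) differentiable (at (cmap (chart_at M (\<iota> z)) (\<iota> z)))"
  shows "dir_deriv N z u (f \<circ> \<iota>) = dir_deriv M (\<iota> z) (differential N M \<iota> z u) f"
    and "(f \<circ> \<iota> \<circ> cinv (chart_at N z)) differentiable (at (cmap (chart_at N z) z))"
  unfolding dir_deriv_def differential_def
  using frechet_derivative_pullback[OF assms(1-3) _ _ _ _ assms(4)]
    chart_at[OF assms(1), of z] chart_at[OF assms(2), of "\<iota> z"] by blast+

text \<open>The components are the Jacobian of \<open>\<iota>\<close> applied to the components of
  \<open>Y\<close>, both smooth near the point. This provides the regularity that the Leibniz rule
  along \<open>\<iota>\<close> requires of the field.\<close>

lemma differential_field_differentiable:
  assumes "smooth_atlas N" "smooth_atlas M" "smooth_map N M \<iota>" "vector_field_near N x Y"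
    and "d \<in> N" "c \<in> M" "x \<in> cdom d" "\<iota> x \<in> cdom c"
  shows "((\<lambda>z. coords M c (\<iota> z) (differential N M \<iota> z (Y z))) \<circ> cinv d) differentiable
    (at (cmap d x))"
proof -
  obtain W where W: "open W" "x \<in> W" "vector_field N W Y"
    using assms(4) unfolding vector_field_near_def by blast
  define S where "S = W \<inter> (cdom d \<inter> \<iota> -` cdom c)"
  note dc = smooth_atlas_is_chart[OF assms(1,5)]
  have "open S"
    using W(1) open_chart_vimage(1)[OF assms(1-3,5,6)] by (auto simp: S_def)
  moreover have "S \<inter> cdom d = S"
    by (auto simp: S_def)
  ultimately have op: "open (cmap d ` S)"
    using open_cmap_image[OF dc, of S] by simp
  have x: "cmap d x \<in> cmap d ` S"
    using W(2) assms(7,8) by (simp add: S_def)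
  have "smooth_on (cmap d ` S) (\<lambda>y. frechet_derivative (cmap c \<circ> \<iota> \<circ> cinv d) (at y)
      (((\<lambda>z. coords N d z (Y z)) \<circ> cinv d) y))"
  proof (rule smooth_on_frechet_derivative_apply[OF op])
    have "smooth_on (cmap d ` (cdom d \<inter> \<iota> -` cdom c)) (cmap c \<circ> \<iota> \<circ> cinv d)"
      using assms(3,5,6) by (simp add: smooth_map_def)
    then show "smooth_on (cmap d ` S) (cmap c \<circ> \<iota> \<circ> cinv d)"
      by (rule smooth_on_subset) (auto simp: S_def)
    have "smooth_on (cmap d ` (W \<inter> cdom d)) ((\<lambda>z. coords N d z (Y z)) \<circ> cinv d)"
      using W(3) assms(5) by (simp add: vector_field_def)
    then show "smooth_on (cmap d ` S) ((\<lambda>z. coords N d z (Y z)) \<circ> cinv d)"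
      by (rule smooth_on_subset) (auto simp: S_def)
  qed
  then have "(\<lambda>y. frechet_derivative (cmap c \<circ> \<iota> \<circ> cinv d) (at y)
      (((\<lambda>z. coords N d z (Y z)) \<circ> cinv d) y)) differentiable (at (cmap d x))"
    using x by (rule smooth_on_imp_differentiable)
  then show ?thesis
  proof (rule differentiable_cong_open[OF op x, rotated])
    show "frechet_derivative (cmap c \<circ> \<iota> \<circ> cinv d) (at y) (((\<lambda>z. coords N d z (Y z)) \<circ> cinv d) y) =
        ((\<lambda>z. coords M c (\<iota> z) (differential N M \<iota> z (Y z))) \<circ> cinv d) y"
      if "y \<in> cmap d ` S" for y
      using that
      by (auto simp: S_def is_chart_cinv_cmap[OF dc] coords_differential[OF assms(1-3,5,6)])
  qed
qed

text \<open>The coordinate formula contains only the values of the components at \<open>x\<close>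
  and their derivatives there.\<close>

lemma conn_along_cong:
  assumes "smooth_atlas N" "open V" "x \<in> V" "\<And>z. z \<in> V \<Longrightarrow> Z z = Z' z"
  shows "conn_along N M \<iota> D x u Z = conn_along N M \<iota> D x u Z'"
proof -
  have "dir_deriv N x u (\<lambda>z. coords M (chart_at M (\<iota> x)) (\<iota> z) (Z z) \<bullet> b) =
      dir_deriv N x u (\<lambda>z. coords M (chart_at M (\<iota> x)) (\<iota> z) (Z' z) \<bullet> b)" for b
    by (rule dir_deriv_cong[OF assms(1-3)]) (simp add: assms(4))
  then show ?thesis
    by (simp add: conn_along_def Let_def assms(3,4))
qed

text \<open>The Leibniz rule for the pull-back connection. It is not immediate, as that connection is
  given in the coordinate frame: both sides are expanded with the matrix of \<open>A\<close> in that frame.\<close>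

lemma conn_along_endo:
  assumes "smooth_atlas N" "smooth_atlas M" "smooth_map N M \<iota>"
    and "connection_on M U D" "open U" "endo_field M U A" "\<iota> x \<in> U"
    and c_def: "c = chart_at M (\<iota> x)"
    and Z: "((\<lambda>z. coords M c (\<iota> z) (Z z)) \<circ> cinv (chart_at N x)) differentiable
        (at (cmap (chart_at N x) x))"
  shows "conn_along N M \<iota> D x u (\<lambda>z. A (\<iota> z) (Z z)) =
    (\<Sum>b\<in>Basis. (coords M c (\<iota> x) (Z x) \<bullet> b) *\<^sub>R
        nabla_endo D A (\<iota> x) (differential N M \<iota> x u) (coord_field M c b))
    + A (\<iota> x) (conn_along N M \<iota> D x u Z)"
proof -
  define p where "p = \<iota> x"
  define u' where "u' = differential N M \<iota> x u"
  define E where "E = coord_field M c"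
  define W where "W = U \<inter> cdom c"
  \<comment> \<open>The entry \<open>a b e\<close> is the component along \<open>e\<close> of
    \<open>A\<close> applied to the frame field \<open>E b\<close>; below, \<open>\<zeta> b\<close>
    is the component of \<open>Z\<close> along \<open>b\<close>.\<close>
  define a where "a = (\<lambda>b e q. coords M c q (A q (E b q)) \<bullet> e)"
  define \<zeta> where "\<zeta> = (\<lambda>b z. coords M c (\<iota> z) (Z z) \<bullet> b)"
  have c: "c \<in> M" "p \<in> cdom c"
    using chart_at[OF assms(2), of "\<iota> x"] by (simp_all add: c_def p_def)
  have W: "open W" "p \<in> W" "W \<subseteq> U" "W \<subseteq> cdom c"
    using assms(5,7) c smooth_atlas_is_chart[OF assms(2) c(1)]
    by (auto simp: W_def p_def is_chart_def)
  have p: "p \<in> U"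
    using W by blast
  have linA: "linear (A q)" if "q \<in> W" for q
    using assms(6) that W(3) by (auto simp: endo_field_def)
  have linc: "linear (coords M c q)" if "q \<in> W" for q
    using linear_coords[OF assms(2) c(1)] that W(4) by blast
  have E: "vector_field M W (E b)" for b
    using vector_field_subset[OF vector_field_coord_field[OF assms(2) c(1)] W(4)]
    by (simp add: E_def)
  have AE: "vector_field M W (\<lambda>q. A q (E b q))" for b
    using assms(6) W(1,3) E unfolding endo_field_def by blast
  have a: "smooth_fun M W (a b e)" for b e
    unfolding a_def by (rule smooth_fun_coords[OF assms(2) c(1) W(1,4) AE])
  have a_diff: "(a b e \<circ> cinv c) differentiable (at (cmap c p))" for b e
    by (rule smooth_fun_imp_differentiable[OF a W(2) c])
  have A_frame: "A q (E b q) = (\<Sum>e\<in>Basis. a b e q *\<^sub>R E e q)" if "q \<in> W" for b q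
    using frame_expansion[OF assms(2) c(1), of q "A q (E b q)"] that W(4) by (auto simp: a_def E_def)
  have Z_frame: "Z z = (\<Sum>b\<in>Basis. \<zeta> b z *\<^sub>R E b (\<iota> z))" if "\<iota> z \<in> W" for z
    using frame_expansion[OF assms(2) c(1), of "\<iota> z" "Z z"] that W(4) by (auto simp: \<zeta>_def E_def)
  have comp: "coords M c (\<iota> z) (A (\<iota> z) (Z z)) \<bullet> e = (\<Sum>b\<in>Basis. \<zeta> b z * a b e (\<iota> z))"
    if z: "\<iota> z \<in> W" for z e
  proof -
    have "coords M c (\<iota> z) (A (\<iota> z) (Z z)) \<bullet> e =
        coords M c (\<iota> z) (A (\<iota> z) (\<Sum>b\<in>Basis. \<zeta> b z *\<^sub>R E b (\<iota> z))) \<bullet> e"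
      by (simp only: Z_frame[OF z, symmetric])
    also have "\<dots> = (\<Sum>b\<in>Basis. \<zeta> b z * a b e (\<iota> z))"
      by (simp add: linear_sum[OF linA[OF z]] linear_scale[OF linA[OF z]]
          linear_sum[OF linc[OF z]] linear_scale[OF linc[OF z]] inner_sum_left a_def)
    finally show ?thesis .
  qed
  \<comment> \<open>The components \<open>\<zeta> b\<close> live on \<open>N\<close> but the matrix
    entries live on \<open>M\<close>. The entries are pulled back for the product rule on
    \<open>N\<close>, and then their derivatives along \<open>u\<close> become derivatives along
    \<open>u'\<close>.\<close>
  have dcomp: "dir_deriv N x u (\<lambda>z. coords M c (\<iota> z) (A (\<iota> z) (Z z)) \<bullet> e) =
      (\<Sum>b\<in>Basis. \<zeta> b x * dir_deriv M p u' (a b e) + dir_deriv N x u (\<zeta> b) * a b e p)" for e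
  proof -
    have "open (\<iota> -` W)"
      using assms(3) W(1) by (simp add: smooth_map_def continuous_on_open_vimage)
    then have "dir_deriv N x u (\<lambda>z. coords M c (\<iota> z) (A (\<iota> z) (Z z)) \<bullet> e) =
        dir_deriv N x u (\<lambda>z. \<Sum>b\<in>Basis. \<zeta> b z * (a b e \<circ> \<iota>) z)"
      using W(2) comp by (intro dir_deriv_cong[OF assms(1)]) (auto simp: p_def)
    also have "\<dots> = (\<Sum>b\<in>Basis. \<zeta> b x * dir_deriv N x u (a b e \<circ> \<iota>)
        + dir_deriv N x u (\<zeta> b) * (a b e \<circ> \<iota>) x)"
    proof (rule dir_deriv_sum_mult[OF assms(1)])
      fix b
      have "(\<lambda>y. ((\<lambda>z. coords M c (\<iota> z) (Z z)) \<circ> cinv (chart_at N x)) y \<bullet> b) differentiable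
          (at (cmap (chart_at N x) x))"
        by (rule differentiable_inner[OF Z differentiable_const])
      then show "(\<zeta> b \<circ> cinv (chart_at N x)) differentiable (at (cmap (chart_at N x) x))"
        unfolding \<zeta>_def o_def .
      show "(a b e \<circ> \<iota> \<circ> cinv (chart_at N x)) differentiable (at (cmap (chart_at N x) x))"
        using a_diff by (intro dir_deriv_pullback(2)[OF assms(1-3)]) (simp add: c_def p_def)
    qed
    also have "\<dots> = (\<Sum>b\<in>Basis. \<zeta> b x * dir_deriv M p u' (a b e)
        + dir_deriv N x u (\<zeta> b) * a b e p)"
    proof -
      have "dir_deriv N x u (a b e \<circ> \<iota>) = dir_deriv M p u' (a b e)" for b
        unfolding p_def u'_def
        using a_diff by (intro dir_deriv_pullback(1)[OF assms(1-3)]) (simp add: c_def p_def)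
      then show ?thesis
        by (simp add: p_def)
    qed
    finally show ?thesis .
  qed
  have DAE: "D p u' (\<lambda>q. A q (E b q)) =
      (\<Sum>e\<in>Basis. dir_deriv M p u' (a b e) *\<^sub>R E e p + a b e p *\<^sub>R D p u' (E e))" for b
  proof -
    have sm: "vector_field M W (\<lambda>q. a b e q *\<^sub>R E e q)" for e
      by (rule vector_field_scaleR[OF assms(2) W(1) a E])
    \<comment> \<open>The frame expansion is valid on \<open>W\<close> only, so the locality of
      \<open>D\<close> is used here.\<close>
    have "D p u' (\<lambda>q. A q (E b q)) = D p u' (\<lambda>q. \<Sum>e\<in>Basis. a b e q *\<^sub>R E e q)"
      using A_frame
      by (intro connection_on_cong[OF assms(2,4) p _ _ W(1,2)] vector_field_nearI[OF W(1,2)]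
          vector_field_sum[OF assms(2) W(1)] sm AE) auto
    also have "\<dots> = (\<Sum>e\<in>Basis. D p u' (\<lambda>q. a b e q *\<^sub>R E e q))"
      by (intro connection_on_sum[OF assms(2,4) p W(1,2)] sm) auto
    also have "\<dots> = (\<Sum>e\<in>Basis. dir_deriv M p u' (a b e) *\<^sub>R E e p + a b e p *\<^sub>R D p u' (E e))"
      by (intro sum.cong refl connection_on_scaleR[OF assms(4) p] smooth_fun_nearI[OF W(1,2)]
          vector_field_nearI[OF W(1,2)] a E)
    finally show ?thesis .
  qed
  have "conn_along N M \<iota> D x u (\<lambda>z. A (\<iota> z) (Z z)) =
      (\<Sum>e\<in>Basis. (\<Sum>b\<in>Basis. \<zeta> b x * dir_deriv M p u' (a b e)
          + dir_deriv N x u (\<zeta> b) * a b e p) *\<^sub>R E e p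
        + (\<Sum>b\<in>Basis. \<zeta> b x * a b e p) *\<^sub>R D p u' (E e))"
    unfolding conn_along_def Let_def c_def[symmetric] dcomp
    using comp[of x] W(2) by (simp add: E_def p_def u'_def)
  also have "\<dots> = (\<Sum>e\<in>Basis. \<Sum>b\<in>Basis. dir_deriv N x u (\<zeta> b) *\<^sub>R a b e p *\<^sub>R E e p
        + \<zeta> b x *\<^sub>R (dir_deriv M p u' (a b e) *\<^sub>R E e p + a b e p *\<^sub>R D p u' (E e)))"
    by (simp add: scaleR_sum_left sum.distrib[symmetric] algebra_simps)
  \<comment> \<open>Once grouped by the index \<open>b\<close> of \<open>Z\<close>, the sums over
    \<open>e\<close> close up to \<open>A p (E b p)\<close> and, by \<open>DAE\<close>, to the
    derivative of the field \<open>A (E b)\<close>.\<close>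
  also have "\<dots> = (\<Sum>b\<in>Basis. \<Sum>e\<in>Basis. dir_deriv N x u (\<zeta> b) *\<^sub>R a b e p *\<^sub>R E e p
        + \<zeta> b x *\<^sub>R (dir_deriv M p u' (a b e) *\<^sub>R E e p + a b e p *\<^sub>R D p u' (E e)))"
    by (rule sum.swap)
  also have "\<dots> = (\<Sum>b\<in>Basis. dir_deriv N x u (\<zeta> b) *\<^sub>R A p (E b p)
        + \<zeta> b x *\<^sub>R D p u' (\<lambda>q. A q (E b q)))"
    by (simp add: A_frame[OF W(2)] DAE sum.distrib scaleR_sum_right scaleR_add_right)
  \<comment> \<open>The derivative of \<open>A (E b)\<close> is the term with
    \<open>nabla_endo\<close> plus \<open>A\<close> of the derivative of \<open>E b\<close>. The
    latter completes the image under \<open>A\<close> of the coordinate formula for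
    \<open>Z\<close>.\<close>
  also have "\<dots> = (\<Sum>b\<in>Basis. \<zeta> b x *\<^sub>R nabla_endo D A p u' (E b))
      + (\<Sum>b\<in>Basis. dir_deriv N x u (\<zeta> b) *\<^sub>R A p (E b p) + \<zeta> b x *\<^sub>R A p (D p u' (E b)))"
    by (simp add: nabla_endo_def sum.distrib[symmetric] algebra_simps)
  also have "(\<Sum>b\<in>Basis. dir_deriv N x u (\<zeta> b) *\<^sub>R A p (E b p) + \<zeta> b x *\<^sub>R A p (D p u' (E b))) =
      A p (conn_along N M \<iota> D x u Z)"
    unfolding conn_along_def Let_def c_def[symmetric]
    using linA[OF W(2)]
    by (simp add: linear_sum linear_add linear_scale E_def \<zeta>_def u'_def p_def)
  finally show ?thesis
    by (simp add: \<zeta>_def p_def u'_def E_def)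
qed


section \<open>The tangential projection\<close>

text \<open>Two candidates differ by a vector orthogonal to the whole tangent space of
  \<open>N\<close>, which is 0 because the pulled-back form is non-degenerate.\<close>

lemma tangential_eqI:
  assumes "nondegenerate (pullback_form N M \<iota> \<omega>)" "linear (differential N M \<iota> y)"
    and "bilinear (\<omega> (\<iota> y))" "w - differential N M \<iota> y v \<in> normal_space N M \<iota> \<omega> y"
  shows "tangential N M \<iota> \<omega> y w = v"
  unfolding tangential_def
proof (rule the_equality)
  fix v' assume "w - differential N M \<iota> y v' \<in> normal_space N M \<iota> \<omega> y"
  with assms(4) have "pullback_form N M \<iota> \<omega> y (v' - v) z = 0" for z
    by (simp add: pullback_form_def normal_space_def bilinear_lsub[OF assms(3)]
        linear_diff[OF assms(2)])
  then have "v' - v = 0"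
    using assms(1) unfolding nondegenerate_def by blast
  then show "v' = v" by simp
qed fact

text \<open>Existence of the projection: an injective endomorphism of a finite-dimensional space is
  onto, so every functional on the tangent space of \<open>N\<close> is represented through the
  non-degenerate pulled-back form.\<close>

lemma tangential:
  assumes "nondegenerate (pullback_form N M \<iota> \<omega>)" "linear (differential N M \<iota> y)"
    and "bilinear (\<omega> (\<iota> y))"
  shows "w - differential N M \<iota> y (tangential N M \<iota> \<omega> y w) \<in> normal_space N M \<iota> \<omega> y"
proof -
  let ?d = "differential N M \<iota> y" and ?f = "pullback_form N M \<iota> \<omega> y"
  have lin_w: "linear (\<lambda>v. \<omega> (\<iota> y) w (?d v))" for w
    using linear_compose[OF assms(2), of "\<omega> (\<iota> y) w"] assms(3) by (simp add: bilinear_def o_def)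
  have lin_l: "linear (\<lambda>v. ?f v b)" for b
    using linear_compose[OF assms(2), of "\<lambda>w. \<omega> (\<iota> y) w (?d b)"] assms(3)
    by (simp add: bilinear_def o_def pullback_form_def)
  \<comment> \<open>\<open>T v\<close> represents the functional \<open>?f v\<close> with respect to
    the Euclidean inner product. Solving \<open>T v = ...\<close> for the functional of
    \<open>w\<close> yields the tangential part.\<close>
  define T where "T v = (\<Sum>b\<in>Basis. ?f v b *\<^sub>R b)" for v
  have T: "T v \<bullet> b = ?f v b" if "b \<in> Basis" for v b
    using that by (simp add: T_def)
  have "linear T"
    unfolding T_def
    by (intro linearI) (simp_all add: linear_add[OF lin_l] linear_scale[OF lin_l]
        scaleR_add_left sum.distrib scaleR_sum_right)
  moreover have "inj T"
    unfolding linear_injective_0[OF \<open>linear T\<close>]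
  proof (intro allI impI)
    fix v assume "T v = 0"
    then have "?f v b = 0" if "b \<in> Basis" for b
      using T[OF that, of v] by simp
    then have "?f v z = 0" for z
      using linear_sum_Basis[OF lin_w[of "?d v"], of z] by (simp add: pullback_form_def)
    then show "v = 0"
      using assms(1) unfolding nondegenerate_def by blast
  qed
  ultimately have "surj T"
    by (rule linear_injective_imp_surjective) simp
  then obtain v where v: "T v = (\<Sum>b\<in>Basis. \<omega> (\<iota> y) w (?d b) *\<^sub>R b)"
    by (metis surjD)
  have eq: "?f v b = \<omega> (\<iota> y) w (?d b)" if "b \<in> Basis" for b
    using T[OF that, of v] that by (simp add: v)
  \<comment> \<open>Orthogonality is known on the images of basis vectors only; linearity extends it
    to all \<open>z\<close>.\<close>
  have "\<omega> (\<iota> y) (w - ?d v) (?d z) = 0" for z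
    unfolding linear_sum_Basis[OF lin_w, of "w - ?d v" z]
    using eq by (simp add: pullback_form_def bilinear_lsub[OF assms(3)])
  then have "w - ?d v \<in> normal_space N M \<iota> \<omega> y"
    by (simp add: normal_space_def)
  moreover from this have "tangential N M \<iota> \<omega> y w = v"
    by (rule tangential_eqI[OF assms])
  ultimately show ?thesis by simp
qed

text \<open>If the tangential part is 0, the normal remainder is \<open>w\<close> itself. Thus a
  vanishing projection can be tested with \<open>\<omega>\<close> against tangent vectors.\<close>

lemma tangential_eq_0_iff:
  assumes "nondegenerate (pullback_form N M \<iota> \<omega>)" "linear (differential N M \<iota> y)"
    and "bilinear (\<omega> (\<iota> y))"
  shows "tangential N M \<iota> \<omega> y w = 0 \<longleftrightarrow> w \<in> normal_space N M \<iota> \<omega> y"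
  using tangential[OF assms, of w] tangential_eqI[OF assms, of w 0] linear_0[OF assms(2)] by auto


section \<open>The covariant derivative of the complex structure\<close>

text \<open>As \<open>J\<close> is an \<open>\<omega>\<close>-isometry preserving \<open>T\<^sub>yN\<close>, it preserves the normal space.\<close>

lemma tangential_add_endo:
  assumes "nondegenerate (pullback_form N M \<iota> \<omega>)" "linear (differential N M \<iota> y)"
    and "bilinear (\<omega> (\<iota> y))" "linear J"
    and "\<And>v. J (J v) = - v" "\<And>u v. \<omega> (\<iota> y) (J u) (J v) = \<omega> (\<iota> y) u v"
    and "\<And>v. J (differential N M \<iota> y v) = differential N M \<iota> y (Jh v)"
  shows "tangential N M \<iota> \<omega> y (K + J w) =
    tangential N M \<iota> \<omega> y K + Jh (tangential N M \<iota> \<omega> y w)"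
proof (rule tangential_eqI[OF assms(1-3)])
  let ?d = "differential N M \<iota> y" and ?t = "tangential N M \<iota> \<omega> y"
  let ?nrm = "w - ?d (?t w)"
  have normal: "\<omega> (\<iota> y) (u - ?d (?t u)) (?d v) = 0" for u v
    using tangential[OF assms(1-3), of u] by (simp add: normal_space_def)
  have J_normal: "\<omega> (\<iota> y) (J ?nrm) (?d v) = 0" for v
  proof -
    \<comment> \<open>Applying the isometry \<open>J\<close> to both arguments turns
      \<open>J ?nrm\<close> into \<open>- ?nrm\<close> and keeps the second argument
      tangent.\<close>
    have "\<omega> (\<iota> y) (J ?nrm) (?d v) = \<omega> (\<iota> y) (- ?nrm) (?d (Jh v))"
      by (simp only: assms(6)[of "J ?nrm" "?d v", symmetric] assms(5,7))
    also have "\<dots> = 0"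
      by (simp only: bilinear_lneg[OF assms(3)] normal neg_0_equal_iff_equal)
    finally show ?thesis .
  qed
  have split: "K + J w - ?d (?t K + Jh (?t w)) = (K - ?d (?t K)) + J ?nrm"
    by (simp add: linear_add[OF assms(2)] linear_diff[OF assms(4)] assms(7))
  show "K + J w - ?d (?t K + Jh (?t w)) \<in> normal_space N M \<iota> \<omega> y"
    unfolding split normal_space_def
    by (simp only: mem_Collect_eq bilinear_ladd[OF assms(3)] normal J_normal add_0_left simp_thms)
qed

text \<open>The Leibniz rule along \<open>\<iota>\<close> produces a term from the derivative of
  \<open>J 1\<close> and \<open>J 1\<close> applied to the derivative of the field. After projection
  the latter is \<open>Jh\<close> of the induced derivative and cancels in
  \<open>nabla_endo\<close>.\<close>

lemma nabla_endo_induced_connection: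
  assumes "smooth_atlas N" "smooth_atlas M" "smooth_map N M \<iota>"
    and "nondegenerate (pullback_form N M \<iota> \<omega>)" "bilinear (\<omega> (\<iota> x))"
    and "connection_on M UNIV D" "connection_forms M U D J \<gamma>"
    and "open U" "endo_field M U (J 1)" "open V" "\<iota> ` V \<subseteq> U" "x \<in> V"
    and "\<And>v. J 1 (\<iota> x) (J 1 (\<iota> x) v) = - v"
    and "\<And>u v. \<omega> (\<iota> x) (J 1 (\<iota> x) u) (J 1 (\<iota> x) v) = \<omega> (\<iota> x) u v"
    and "linear (J 2 (\<iota> x))" "linear (J 3 (\<iota> x))"
    and "\<And>z v. z \<in> V \<Longrightarrow> J 1 (\<iota> z) (differential N M \<iota> z v) = differential N M \<iota> z (Jh z v)"
    and "vector_field_near N x Y"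
  shows "nabla_endo (induced_connection N M \<iota> \<omega> D) Jh x u Y =
    tangential N M \<iota> \<omega> x
      (\<gamma> 3 (\<iota> x) (differential N M \<iota> x u) *\<^sub>R J 2 (\<iota> x) (differential N M \<iota> x (Y x))
       - \<gamma> 2 (\<iota> x) (differential N M \<iota> x u) *\<^sub>R J 3 (\<iota> x) (differential N M \<iota> x (Y x)))"
proof -
  let ?d = "differential N M \<iota>" and ?t = "tangential N M \<iota> \<omega> x"
  let ?c = "chart_at M (\<iota> x)"
  let ?Z = "\<lambda>z. ?d z (Y z)"
  define g where "g a = \<gamma> a (\<iota> x) (?d x u)" for a
  note c = chart_at[OF assms(2), of "\<iota> x"] and d = chart_at[OF assms(1), of x]
  have \<iota>x: "\<iota> x \<in> U"
    using assms(11,12) by blast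
  have D: "connection_on M U D"
    using assms(6) unfolding connection_on_def by simp
  \<comment> \<open>The relation between \<open>Jh\<close> and \<open>J 1\<close> is needed on the
    neighbourhood \<open>V\<close>, since the field is differentiated.\<close>
  have "conn_along N M \<iota> D x u (\<lambda>z. ?d z (Jh z (Y z))) =
      conn_along N M \<iota> D x u (\<lambda>z. J 1 (\<iota> z) (?Z z))"
    using assms(17) by (intro conn_along_cong[OF assms(1,10,12)]) simp
  also have "\<dots> = (\<Sum>b\<in>Basis. (coords M ?c (\<iota> x) (?Z x) \<bullet> b) *\<^sub>R
        nabla_endo D (J 1) (\<iota> x) (?d x u) (coord_field M ?c b))
      + J 1 (\<iota> x) (conn_along N M \<iota> D x u ?Z)"
    by (rule conn_along_endo[OF assms(1-3) D assms(8,9) \<iota>x refl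
          differential_field_differentiable[OF assms(1-3,18) d(1) c(1) d(2) c(2)]])
  also have "(\<Sum>b\<in>Basis. (coords M ?c (\<iota> x) (?Z x) \<bullet> b) *\<^sub>R
      nabla_endo D (J 1) (\<iota> x) (?d x u) (coord_field M ?c b)) =
      g 3 *\<^sub>R J 2 (\<iota> x) (?Z x) - g 2 *\<^sub>R J 3 (\<iota> x) (?Z x)"
  proof -
    have nab: "nabla_endo D (J 1) (\<iota> x) (?d x u) (coord_field M ?c b) =
        g 3 *\<^sub>R J 2 (\<iota> x) (coord_field M ?c b (\<iota> x)) - g 2 *\<^sub>R J 3 (\<iota> x) (coord_field M ?c b (\<iota> x))"
      for b
      using assms(7) \<iota>x vector_field_near_coord_field[OF assms(2) c]
      by (simp add: connection_forms_def g_def)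
    \<comment> \<open>The covariant derivative of \<open>J 1\<close> depends linearly on the value
      of the frame field at the point, so the sum over the frame reassembles its value on
      \<open>?Z x\<close>.\<close>
    have lin: "linear (\<lambda>e. g 3 *\<^sub>R J 2 (\<iota> x) e - g 2 *\<^sub>R J 3 (\<iota> x) e)"
      by (intro linear_compose_sub linear_compose_scale_right assms(15,16))
    show ?thesis
      unfolding nab linear_scale[OF lin, symmetric] linear_sum[OF lin, symmetric]
      by (simp only: frame_expansion[OF assms(2) c])
  qed
  finally have "?t (conn_along N M \<iota> D x u (\<lambda>z. ?d z (Jh z (Y z)))) =
      ?t (g 3 *\<^sub>R J 2 (\<iota> x) (?Z x) - g 2 *\<^sub>R J 3 (\<iota> x) (?Z x))
      + Jh x (?t (conn_along N M \<iota> D x u ?Z))"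
    using assms(9) \<iota>x
    by (simp only:) (intro tangential_add_endo[OF assms(4) linear_differential[OF assms(1-3)] assms(5)]
        assms(13,14) assms(17)[OF assms(12)], auto simp: endo_field_def)
  then show ?thesis
    by (simp add: nabla_endo_def induced_connection_def g_def)
qed

text \<open>The linear algebra for one fixed direction: \<open>s\<close> and \<open>r\<close> stand
  for the values of \<open>\<gamma> 3\<close> and \<open>\<gamma> 2\<close>, and \<open>I\<close>
  for \<open>Jh x\<close>. Over the reals the determinant vanishes only if \<open>r\<close> and
  \<open>s\<close> both do.\<close>

lemma rotated_form_eq_0_iff:
  fixes B :: "'a::real_vector \<Rightarrow> 'b \<Rightarrow> real"
  assumes "\<And>y. I (I y) = - y" "\<And>y v. B (- y) v = - B y v"
  shows "(\<forall>y v. s * B y v + r * B (I y) v = 0) \<longleftrightarrow> r = 0 \<and> s = 0 \<or> (\<forall>y v. B y v = 0)"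
proof
  assume eq: "\<forall>y v. s * B y v + r * B (I y) v = 0"
  have "(r\<^sup>2 + s\<^sup>2) * B y v = 0" for y v
  proof -
    have "s * B y v + r * B (I y) v = 0" "s * B (I y) v - r * B y v = 0"
      using eq[rule_format, of y v] eq[rule_format, of "I y" v] by (simp_all add: assms)
    \<comment> \<open>Elimination: \<open>s\<close> times the first equation minus \<open>r\<close>
      times the second cancels the terms with \<open>B (I y) v\<close>.\<close>
    moreover have "(r\<^sup>2 + s\<^sup>2) * B y v =
        s * (s * B y v + r * B (I y) v) - r * (s * B (I y) v - r * B y v)"
      by (simp add: power2_eq_square algebra_simps)
    ultimately show ?thesis by simp
  qed
  then show "r = 0 \<and> s = 0 \<or> (\<forall>y v. B y v = 0)"
    by (auto simp: sum_power2_eq_zero_iff)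
qed auto

theorem theorem2p31:
  fixes M :: "('m::{t2_space,second_countable_topology}, 'e::euclidean_space) chart set"
    and N :: "('k::{t2_space,second_countable_topology}, 'f::euclidean_space) chart set"
    and Q :: "'m \<Rightarrow> ('e \<Rightarrow> 'e) set"
    and \<omega> :: "'m \<Rightarrow> 'e \<Rightarrow> 'e \<Rightarrow> real"
    and \<iota> :: "'k \<Rightarrow> 'm"
    and Jh :: "'k \<Rightarrow> 'f \<Rightarrow> 'f"
    and \<omega>h gh :: "'k \<Rightarrow> 'f \<Rightarrow> 'f \<Rightarrow> real"
    and D :: "('m, 'e) conn"
    and J :: "nat \<Rightarrow> 'm \<Rightarrow> 'e \<Rightarrow> 'e"
    and \<gamma> :: "nat \<Rightarrow> 'm \<Rightarrow> 'e \<Rightarrow> real"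
    and n k :: nat and U :: "'m set" and V :: "'k set" and x :: 'k
  assumes "n > 1"
    and "almost_qsH n M Q \<omega>"
    and "DIM('f) = 2 * k"
    and "almost_pseudo_Hermitian_submanifold N M Q \<omega> \<iota> Jh \<omega>h gh"
    and "adapted_connection n M Q \<omega> D"
    and "adapted_basis N M Q \<iota> Jh V U J"
    and "connection_forms M U D J \<gamma>"
    and "x \<in> V"
  shows "(\<forall>u Y. vector_field_near N x Y \<longrightarrow>
            nabla_endo (induced_connection N M \<iota> \<omega> D) Jh x u Y = 0) \<longleftrightarrow>
         (\<forall>u. \<gamma> 2 (\<iota> x) (differential N M \<iota> x u) = 0 \<and> \<gamma> 3 (\<iota> x) (differential N M \<iota> x u) = 0) \<or>
         (\<forall>u v. \<omega> (\<iota> x) (J 2 (\<iota> x) (differential N M \<iota> x u)) (differential N M \<iota> x v) = 0)"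
proof -
  let ?d = "differential N M \<iota> x"
  let ?g = "\<lambda>a u. \<gamma> a (\<iota> x) (?d u)"
  let ?J = "\<lambda>a. J a (\<iota> x)"
  \<comment> \<open>Condition (I2) says that this form vanishes; it does not involve the direction
    \<open>u\<close> of differentiation.\<close>
  define B where "B y v = \<omega> (\<iota> x) (?J 2 (?d y)) (?d v)" for y v
  have N: "smooth_atlas N" and M: "smooth_atlas M" and \<iota>: "smooth_map N M \<iota>"
    and nd: "nondegenerate (pullback_form N M \<iota> \<omega>)" and Jh: "Jh x (Jh x v) = - v" for v
    using assms(4) by (auto simp: almost_pseudo_Hermitian_submanifold_def
        almost_complex_submanifold_def submanifold_def almost_complex_structure_def)
  have adm: "admissible_basis M Q U J" and V: "open V" "\<iota> ` V \<subseteq> U"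
    and JJh: "\<And>z v. z \<in> V \<Longrightarrow> J 1 (\<iota> z) (differential N M \<iota> z v) = differential N M \<iota> z (Jh z v)"
    using assms(6) by (auto simp: adapted_basis_def)
  have \<iota>x: "\<iota> x \<in> U"
    using V(2) assms(8) by blast
  have U: "open U" and endo: "endo_field M U (J 1)"
    using adm by (simp_all add: admissible_basis_def)
  have linJ: "linear (?J a)" if "a \<in> {1, 2, 3}" for a
    using adm \<iota>x that unfolding admissible_basis_def endo_field_def by blast
  have J1: "?J 1 (?J 1 w) = - w" and J3: "?J 3 w = - ?J 2 (?J 1 w)" for w
    using adm \<iota>x by (simp_all add: admissible_basis_def)
  have \<omega>: "bilinear (\<omega> (\<iota> x))" and J_iso: "\<omega> (\<iota> x) (?J 1 w) (?J 1 z) = \<omega> (\<iota> x) w z" for w z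
  proof -
    show "bilinear (\<omega> (\<iota> x))"
      using assms(2) by (simp add: almost_qsH_def two_form_def)
    have "\<forall>p\<in>U. \<forall>a\<in>{1,2,3}. \<forall>u v. \<omega> p (J a p u) (J a p v) = \<omega> p u v"
      using assms(2) adm unfolding almost_qsH_def by blast
    then show "\<omega> (\<iota> x) (?J 1 w) (?J 1 z) = \<omega> (\<iota> x) w z"
      using \<iota>x by simp
  qed
  have D: "connection_on M UNIV D"
    using assms(5) by (simp add: adapted_connection_def)
  have lin: "linear ?d"
    by (rule linear_differential[OF N M \<iota>])
  have vanish: "nabla_endo (induced_connection N M \<iota> \<omega> D) Jh x u Y = 0 \<longleftrightarrow>
      (\<forall>v. ?g 3 u * B (Y x) v + ?g 2 u * B (Jh x (Y x)) v = 0)" if Y: "vector_field_near N x Y" for u Y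
  proof -
    have "nabla_endo (induced_connection N M \<iota> \<omega> D) Jh x u Y =
        tangential N M \<iota> \<omega> x (?g 3 u *\<^sub>R ?J 2 (?d (Y x)) - ?g 2 u *\<^sub>R ?J 3 (?d (Y x)))"
      using linJ J1 J_iso
      by (intro nabla_endo_induced_connection[OF N M \<iota> nd \<omega> D assms(7) U endo V assms(8)] JJh Y) auto
    \<comment> \<open>The sign changes because \<open>J 3\<close> is minus \<open>J 2\<close> after
      \<open>J 1\<close>, and \<open>J 1\<close> acts on tangent vectors of \<open>N\<close> as
      \<open>Jh\<close>.\<close>
    also have "\<dots> = tangential N M \<iota> \<omega> x (?g 3 u *\<^sub>R ?J 2 (?d (Y x)) + ?g 2 u *\<^sub>R ?J 2 (?d (Jh x (Y x))))"
      using JJh[OF assms(8)] by (simp add: J3)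
    finally show ?thesis
      by (simp add: tangential_eq_0_iff[OF nd lin \<omega>] normal_space_def B_def
          bilinear_ladd[OF \<omega>] bilinear_lmul[OF \<omega>])
  qed
  \<comment> \<open>By \<open>vanish\<close> only the value of \<open>Y\<close> at \<open>x\<close>
    matters. Constant components in the preferred chart realize every value, so fields can be
    replaced by tangent vectors.\<close>
  have extend: "\<exists>Y. vector_field_near N x Y \<and> Y x = y" for y
  proof (intro exI conjI)
    note d = chart_at[OF N, of x]
    show "vector_field_near N x (coord_field N (chart_at N x) y)"
      by (rule vector_field_near_coord_field[OF N d])
    show "coord_field N (chart_at N x) y x = y"
      unfolding coord_field_def by (rule frechet_derivative_chart_self[OF N d])
  qed
  have "(\<forall>u Y. vector_field_near N x Y \<longrightarrow>
      nabla_endo (induced_connection N M \<iota> \<omega> D) Jh x u Y = 0) \<longleftrightarrow>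
      (\<forall>u y v. ?g 3 u * B y v + ?g 2 u * B (Jh x y) v = 0)"
  proof (intro iffI allI impI)
    fix u y v
    assume *: "\<forall>u Y. vector_field_near N x Y \<longrightarrow>
      nabla_endo (induced_connection N M \<iota> \<omega> D) Jh x u Y = 0"
    obtain Y where Y: "vector_field_near N x Y" "Y x = y"
      using extend by blast
    show "?g 3 u * B y v + ?g 2 u * B (Jh x y) v = 0"
      using vanish[OF Y(1), of u] * Y by simp
  qed (simp add: vanish)
  also have "\<dots> \<longleftrightarrow> (\<forall>u. ?g 2 u = 0 \<and> ?g 3 u = 0 \<or> (\<forall>y v. B y v = 0))"
  proof -
    have "B (- y) v = - B y v" for y v
      using linJ[of 2] by (simp add: B_def linear_neg[OF lin] linear_neg bilinear_lneg[OF \<omega>])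
    from rotated_form_eq_0_iff[where I = "Jh x" and B = B, OF Jh this] show ?thesis
      by (intro arg_cong[where f = All] ext)
  qed
  \<comment> \<open>The alternatives hold for each \<open>u\<close> separately so far. As the second
    one is independent of \<open>u\<close>, the quantifier moves onto the first, which gives (I1) or
    (I2).\<close>
  finally show ?thesis
    unfolding B_def by blast
qed

end
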